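(* Let $\ell:\mathbb{R}^{m\times n}\to\mathbb{R}$ be a (possibly nonconvex) loss. Fix a rank $r$ and a restart frequency $K\ge 1$, and let $\{W_k\}$ be the iterates of the algorithm PESO-LoRA-R (defined in the context), with gradients $G_k=\nabla\ell(W_k)$. Assume: (1) $\ell$ is bounded below and has $L$-Lipschitz continuous gradients. (2) Stochastic gradients $\tilde G_k$ of the full gradient $G_k=\nabla\ell(W_k)$ are accessible and satisfy $\mathbb{E}(\tilde G_k)=G_k$, and there exists $C>0$ such that $\mathbb{V}(\tilde G_k)\le C$. (3) At each iteration the algorithm applies Adam to the low-rank objective $f(A,B)=\ell(W+AB)$ (with $W$ the current anchored weight matrix). For $f$: (i) $\nabla f$ is Lipschitz continuous; (ii) the stochastic gradients are unbiased; (iii) the stochastic gradient variance is bounded. (4) At each restart step, i.e. each $k$ with $(k-1)\bmod K=0$, $$\big\|\mathbb{E}[P_r(\tilde G_k)]-P_r(G_k)\big\|_F\le\varepsilon_k,\qquad \sum_k\eta_k\varepsilon_k^2<\infty,$$ where $\eta_k$ is the restart step size used at step $k$. Let $T$ be the total number of iterations and $S=\lfloor T/K\rfloor$ the number of restart cycles. Choose the hyperparameters as follows: every restart step size equals $1/\sqrt{S}$; in each restart cycle $s$ the Adam step sizes are $\alpha_{s,t}=a_s/\sqrt{t}$, $t=1,\dots,K$, with $a_s=1/S$; the Adam states are reset to $0$ at the start of each cycle; and $\beta_2\in(0,1)$, $\beta_{1,t}\in[0,\bar\beta_1]$ with $\bar\beta_1\in[0,1)$. Then $$\min_{0\le k\le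 T-1}\mathbb{E}\|\nabla\ell(W_k)\|_2^2=\mathcal{O}\!\left(1/\sqrt{T}\right).$$
   Context: $\|\cdot\|_F$ is the Frobenius norm and $\|\cdot\|_2$ the spectral norm of a matrix. $\mathbb{V}(X)=\mathbb{E}\|X-\mathbb{E}X\|_F^2$ denotes variance. $P_r(G)$ is the rank-$r$ truncated singular value decomposition of $G$, i.e. its best rank-$r$ approximation in Frobenius norm. Algorithm PESO-LoRA-R (the version analyzed, with Adam as inner optimizer). Start from a given $W_0\in\mathbb{R}^{m\times n}$. Iterations $k=1,2,\dots$ are grouped into restart cycles $s=0,1,\dots$ of length $K$; cycle $s$ starts at the restart step $k_s=sK+1$. Let $\tilde W_s$ be the full weight matrix at the start of cycle $s$ before the restart (the anchored state; $\tilde W_0=W_0$). At the restart, a stochastic estimate $\tilde G_{k_s}$ of $G_{k_s}=\nabla\ell(\tilde W_s)$ is computed, together with a top-$r$ SVD $U\Lambda V^\top$ of $-\tilde G_{k_s}$, and, with restart step size $\eta=\eta_{k_s}$, one sets $A_{s,0}=\sqrt{\eta}\,U\sqrt{\Lambda}\in\mathbb{R}^{m\times r}$ and $B_{s,0}=\sqrt{\eta}\,\sqrt{\Lambda}\,V^\top\in\mathbb{R}^{r\times n}$, so that $A_{s,0}B_{s,0}=-\eta P_r(\tilde G_{k_s})$. Then, with $X=(A,B)$, $X_{s,0}=(A_{s,0},B_{s,0})$ and $m_{s,0}=v_{s,0}=0$, one performs $K$ Adam steps on $f_s(A,B)=\ell(\tilde W_s+AB)$: for $t=1,\dots,K$,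 using a stochastic gradient $g_{s,t}$ of $f_s$ at $X_{s,t-1}$, $$m_{s,t}=\beta_{1,t}m_{s,t-1}+(1-\beta_{1,t})g_{s,t},\qquad v_{s,t}=\beta_2v_{s,t-1}+(1-\beta_2)g_{s,t}^{\odot2},$$ $$\hat m_{s,t}=\frac{m_{s,t}}{1-\prod_{j=1}^t\beta_{1,j}},\qquad \hat v_{s,t}=\frac{v_{s,t}}{1-\beta_2^t},\qquad X_{s,t}=X_{s,t-1}-\alpha_{s,t}\frac{\hat m_{s,t}}{\sqrt{\hat v_{s,t}}+\epsilon},$$ with all operations entrywise and $\epsilon>0$ a fixed Adam parameter. Writing $X_{s,t}=(A_{s,t},B_{s,t})$, the next cycle starts from $\tilde W_{s+1}=\tilde W_s+A_{s,K}B_{s,K}$. $W_k$ ($k\ge1$) is the full weight matrix at the beginning of iteration $k$, before any restart made in that iteration: $W_{k_s}=\tilde W_s$ and $W_{k_s+t}=\tilde W_s+A_{s,t}B_{s,t}$ for $1\le t\le K$. *)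

theory Defs
  imports "HOL-Probability.Probability" "HOL-Library.Landau_Symbols"
begin

definition gradient :: "('a::real_inner \<Rightarrow> real) \<Rightarrow> 'a \<Rightarrow> 'a" where
  "gradient f x = (THE D. GDERIV f x :> D)"

(* The Frobenius norm is the library norm on real^'n^'m. *)
definition spectral_norm :: "real^'n^'m \<Rightarrow> real" where
  "spectral_norm A = onorm ((*v) A)"


(* Singular triples are indexed by 0, 1, ... in decreasing order of the singular values.  Only
   the first q = min m n are genuine; the later singular values are 0 by convention, so that the
   truncation below is defined for every rank (and is G itself for ranks >= q). *)
definition is_svd ::
  "real^'n^'m \<Rightarrow> (nat \<Rightarrow> real) \<Rightarrow> (nat \<Rightarrow> real^'m) \<Rightarrow> (nat \<Rightarrow> real^'n) \<Rightarrow> bool" where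
  "is_svd G \<sigma> u v \<longleftrightarrow> (let q = min CARD('m) CARD('n) in
     antimono \<sigma> \<and> (\<forall>i. 0 \<le> \<sigma> i) \<and> (\<forall>i\<ge>q. \<sigma> i = 0) \<and>
     (\<forall>i<q. \<forall>j<q. u i \<bullet> u j = (if i = j then 1 else 0)) \<and>
     (\<forall>i<q. \<forall>j<q. v i \<bullet> v j = (if i = j then 1 else 0)) \<and>
     G = (\<chi> a b. \<Sum>i<q. \<sigma> i * u i $ a * v i $ b))"

(* A relation because P_r(G) depends on the chosen SVD when the r-th singular value is
   repeated. *)
definition is_truncated_svd :: "nat \<Rightarrow> real^'n^'m \<Rightarrow> real^'n^'m \<Rightarrow> bool" where
  "is_truncated_svd r G Q \<longleftrightarrow> (\<exists>\<sigma> u v. is_svd G \<sigma> u v \<and>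
     Q = (\<chi> a b. \<Sum>i<r. \<sigma> i * u i $ a * v i $ b))"

(* The rank is r = CARD('r).  The type 'r carries no order, hence the enumeration e. *)
definition is_top_svd ::
  "real^'n^'m \<Rightarrow> real^'r^'m \<Rightarrow> real^'r^'r \<Rightarrow> real^'r^'n \<Rightarrow> bool" where
  "is_top_svd G U \<Lambda> V \<longleftrightarrow> (\<exists>\<sigma> u v e. is_svd G \<sigma> u v \<and>
     bij_betw e (UNIV :: 'r set) {..<CARD('r)} \<and>
     (\<forall>j. column j U = u (e j)) \<and> (\<forall>j. column j V = v (e j)) \<and>
     \<Lambda> = (\<chi> i j. if i = j then \<sigma> (e i) else 0))"


primrec adam_m :: "(nat \<Rightarrow> real) \<Rightarrow> (nat \<Rightarrow> real^'b^'a) \<Rightarrow> nat \<Rightarrow> real^'b^'a" where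
  "adam_m \<beta>1 g 0 = 0"
| "adam_m \<beta>1 g (Suc t) = \<beta>1 (Suc t) *\<^sub>R adam_m \<beta>1 g t + (1 - \<beta>1 (Suc t)) *\<^sub>R g (Suc t)"

primrec adam_v :: "real \<Rightarrow> (nat \<Rightarrow> real^'b^'a) \<Rightarrow> nat \<Rightarrow> real^'b^'a" where
  "adam_v \<beta>2 g 0 = 0"
| "adam_v \<beta>2 g (Suc t) =
     \<beta>2 *\<^sub>R adam_v \<beta>2 g t + (1 - \<beta>2) *\<^sub>R (\<chi> i j. (g (Suc t) $ i $ j)\<^sup>2)"

definition adam_m_hat :: "(nat \<Rightarrow> real) \<Rightarrow> (nat \<Rightarrow> real^'b^'a) \<Rightarrow> nat \<Rightarrow> real^'b^'a" where
  "adam_m_hat \<beta>1 g t = (1 / (1 - (\<Prod>j=1..t. \<beta>1 j))) *\<^sub>R adam_m \<beta>1 g t"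

definition adam_v_hat :: "real \<Rightarrow> (nat \<Rightarrow> real^'b^'a) \<Rightarrow> nat \<Rightarrow> real^'b^'a" where
  "adam_v_hat \<beta>2 g t = (1 / (1 - \<beta>2 ^ t)) *\<^sub>R adam_v \<beta>2 g t"

primrec adam_iterate ::
  "(nat \<Rightarrow> real) \<Rightarrow> (nat \<Rightarrow> real) \<Rightarrow> real \<Rightarrow> real \<Rightarrow> real^'b^'a \<Rightarrow> (nat \<Rightarrow> real^'b^'a) \<Rightarrow> nat
     \<Rightarrow> real^'b^'a" where
  "adam_iterate \<alpha> \<beta>1 \<beta>2 eps x0 g 0 = x0"
| "adam_iterate \<alpha> \<beta>1 \<beta>2 eps x0 g (Suc t) = adam_iterate \<alpha> \<beta>1 \<beta>2 eps x0 g t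
     - \<alpha> (Suc t) *\<^sub>R (\<chi> i j. adam_m_hat \<beta>1 g (Suc t) $ i $ j /
                         (sqrt (adam_v_hat \<beta>2 g (Suc t) $ i $ j) + eps))"


type_synonym ('m, 'r, 'n) factors = "(real^'r^'m) \<times> (real^'n^'r)"

(* Pitfall: f(A,B) = l(W + AB) is invariant under (A,B) -> (A/c, cB).  If l is bounded below and
   the gradient of f is Lipschitz on the whole space, this invariance forces the gradient of l
   at W to vanish.  Lipschitz continuity of the gradient of f is therefore only meaningful on
   the region explored by the iterates. *)
definition lora_objective ::
  "(real^'n^'m \<Rightarrow> real) \<Rightarrow> real^'n^'m \<Rightarrow> ('m, 'r::finite, 'n) factors \<Rightarrow> real" where
  "lora_objective l W X = l (W + fst X ** snd X)"

(* X = (A_0, B_0) is an admissible restart from the estimate Gt.  P is the selection of rank-r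
   truncated SVDs; the SVD used for -Gt is consistent with it, so A_0 B_0 = - eta P(Gt). *)
definition lora_restart ::
  "(real^'n^'m \<Rightarrow> real^'n^'m) \<Rightarrow> real \<Rightarrow> real^'n^'m \<Rightarrow> ('m, 'r::finite, 'n) factors \<Rightarrow> bool" where
  "lora_restart P \<eta> Gt X \<longleftrightarrow> (\<exists>U \<Lambda> V.
     is_top_svd (- Gt) U \<Lambda> V \<and> U ** \<Lambda> ** transpose V = - P Gt \<and>
     fst X = sqrt \<eta> *\<^sub>R (U ** (\<chi> i j. sqrt (\<Lambda> $ i $ j))) \<and>
     snd X = sqrt \<eta> *\<^sub>R ((\<chi> i j. sqrt (\<Lambda> $ i $ j)) ** transpose V))"

(* X_{s,t}, given the restart points x0 s and the stochastic gradients g s t.  Adam acts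
   entrywise, so the pair (A,B) is updated componentwise. *)
definition lora_iterate ::
  "(nat \<Rightarrow> nat \<Rightarrow> real) \<Rightarrow> (nat \<Rightarrow> real) \<Rightarrow> real \<Rightarrow> real \<Rightarrow> (nat \<Rightarrow> ('m::finite, 'r::finite, 'n::finite) factors)
     \<Rightarrow> (nat \<Rightarrow> nat \<Rightarrow> ('m::finite, 'r::finite, 'n::finite) factors) \<Rightarrow> nat \<Rightarrow> nat \<Rightarrow> ('m::finite, 'r::finite, 'n::finite) factors" where
  "lora_iterate \<alpha> \<beta>1 \<beta>2 eps x0 g s t =
     (adam_iterate (\<alpha> s) \<beta>1 \<beta>2 eps (fst (x0 s)) (\<lambda>j. fst (g s j)) t,
      adam_iterate (\<alpha> s) \<beta>1 \<beta>2 eps (snd (x0 s)) (\<lambda>j. snd (g s j)) t)"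

primrec anchor ::
  "nat \<Rightarrow> real^'n^'m \<Rightarrow> (nat \<Rightarrow> nat \<Rightarrow> ('m, 'r::finite, 'n) factors) \<Rightarrow> nat \<Rightarrow> real^'n^'m" where
  "anchor K W0 X 0 = W0"
| "anchor K W0 X (Suc s) = anchor K W0 X s + fst (X s K) ** snd (X s K)"

(* Weights before iteration k = 1, 2, ...; index 0 is the given W_0 (which equals W_1). *)
definition weight ::
  "nat \<Rightarrow> real^'n^'m \<Rightarrow> (nat \<Rightarrow> nat \<Rightarrow> ('m, 'r::finite, 'n) factors) \<Rightarrow> nat \<Rightarrow> real^'n^'m" where
  "weight K W0 X k = (if k = 0 then W0 else
     let s = (k - 1) div K; t = (k - 1) mod K in
       if t = 0 then anchor K W0 X s else anchor K W0 X s + fst (X s t) ** snd (X s t))"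

definition restart_step :: "nat \<Rightarrow> nat \<Rightarrow> nat" where
  "restart_step K s = s * K + 1"


(* The library has conditional expectations of real-valued functions only. *)
definition vec_cond_exp :: "'w measure \<Rightarrow> 'w measure \<Rightarrow> ('w \<Rightarrow> 'a::euclidean_space) \<Rightarrow> 'w \<Rightarrow> 'a" where
  "vec_cond_exp M F X \<omega> = (\<Sum>b\<in>Basis. real_cond_exp M F (\<lambda>\<omega>. X \<omega> \<bullet> b) \<omega> *\<^sub>R b)"

(* Extended-valued, since real_cond_exp would turn an infinite variance into 0. *)
definition cond_variance ::
  "'w measure \<Rightarrow> 'w measure \<Rightarrow> ('w \<Rightarrow> 'a::euclidean_space) \<Rightarrow> 'w \<Rightarrow> ennreal" where
  "cond_variance M F X = nn_cond_exp M F (\<lambda>\<omega>. ennreal ((norm (X \<omega> - vec_cond_exp M F X \<omega>))\<^sup>2))"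

(* X, known once F' is, estimates the random gradient D without bias and with variance at most C
   given the past F. *)
definition stochastic_gradient ::
  "'w measure \<Rightarrow> 'w measure \<Rightarrow> 'w measure \<Rightarrow> ('w \<Rightarrow> 'a::euclidean_space) \<Rightarrow> ('w \<Rightarrow> 'a) \<Rightarrow> real
     \<Rightarrow> bool" where
  "stochastic_gradient M F F' X D C \<longleftrightarrow>
     X \<in> borel_measurable F' \<and> integrable M X \<and>
     (AE \<omega> in M. vec_cond_exp M F X \<omega> = D \<omega>) \<and>
     (AE \<omega> in M. cond_variance M F X \<omega> \<le> ennreal C)"

(* H k: everything drawn before iteration k; R k: additionally what is drawn for the estimate of
   the full gradient and for the restart in iteration k, but not yet the Adam gradient. *)
definition histories :: "'w measure \<Rightarrow> (nat \<Rightarrow> 'w measure) \<Rightarrow> (nat \<Rightarrow> 'w measure) \<Rightarrow> bool" where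
  "histories M H R \<longleftrightarrow> (\<forall>k. subalgebra M (H k) \<and> subalgebra M (R k) \<and>
     subalgebra (R k) (H k) \<and> subalgebra (H (Suc k)) (R k))"

end

theory Submission
  imports Defs
begin

text \<open>
  A cycle has a fixed number \<open>K\<close> of Adam steps, so the Adam direction is bounded entrywise by a
  constant, whatever the gradients are. Let \<open>h = 1/\<surd>S\<close> be the restart step size; the Adam step
  sizes are at most \<open>1/S = h\<^sup>2\<close>. Since the restart factors have norm \<open>O(\<surd>(h \<parallel>G\<parallel>))\<close>, where \<open>G\<close> is the
  restart estimate, a whole cycle moves the weights by \<open>- h P(G) + e\<close> with
  \<open>\<parallel>e\<parallel>\<^sup>2 = O(h\<^sup>5 (1 + \<parallel>G\<parallel>\<^sup>2))\<close>. So the cycles are perturbed steps of a projected stochastic gradient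
  descent, which decreases the loss because \<open>\<langle>D, P(D)\<rangle> \<ge> \<sigma>\<^sub>1(D)\<^sup>2 \<ge> \<parallel>D\<parallel>\<^sup>2 / min(m,n)\<close> in the Frobenius
  norm. The error terms are \<open>O(h\<^sup>2)\<close> or \<open>O(h \<epsilon>\<^sup>2)\<close> per cycle and add up to \<open>O(1)\<close>; telescoping gives
  \<open>h \<Sum> E \<parallel>\<nabla>l\<parallel>\<^sup>2 = O(1)\<close> over the \<open>S\<close> restart steps.
\<close>

subsection \<open>Lipschitz gradients\<close>

text \<open>The vector \<open>D\<close> collects the values of the derivative on the orthonormal
  basis (Riesz representation). Since \<open>gradient\<close> is a definite description, uniqueness
  of the derivative is needed as well.\<close>

lemma GDERIV_gradient:
  fixes f :: "'a::euclidean_space \<Rightarrow> real"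
  assumes "f differentiable (at x)"
  shows "GDERIV f x :> gradient f x"
proof -
  obtain f' where f': "(f has_derivative f') (at x)"
    using assms by (auto simp: differentiable_def)
  define D where "D = (\<Sum>b\<in>Basis. f' b *\<^sub>R b)"
  have "f' h = h \<bullet> D" for h
  proof -
    have "f' h = f' (\<Sum>b\<in>Basis. (h \<bullet> b) *\<^sub>R b)"
      by (simp add: euclidean_representation)
    also have "\<dots> = (\<Sum>b\<in>Basis. (h \<bullet> b) * f' b)"
      using has_derivative_linear[OF f'] by (simp add: linear_sum linear_cmul)
    finally show ?thesis
      by (simp add: D_def inner_sum_right mult.commute)
  qed
  then have "f' = (\<lambda>h. h \<bullet> D)" by blast
  with f' have D: "GDERIV f x :> D"
    by (simp add: gderiv_def)
  have "gradient f x = D"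
    unfolding gradient_def
  proof (rule the_equality)
    show "GDERIV f x :> D" by (fact D)
    fix D' assume "GDERIV f x :> D'"
    then have "(\<lambda>h. h \<bullet> D') = (\<lambda>h. h \<bullet> D)"
      using D unfolding gderiv_def by (rule has_derivative_unique)
    then show "D' = D"
      by (metis vector_eq_ldot)
  qed
  with D show ?thesis by simp
qed

text \<open>Mean value theorem on the segment from \<open>x\<close> to \<open>x + d\<close>: the
  gradient at the intermediate point differs from the one at \<open>x\<close> by at most
  \<open>L * norm d\<close>. This gives \<open>L\<close> in place of the sharp \<open>L / 2\<close>,
  which is enough for a rate.\<close>

lemma lipschitz_gradient_taylor:
  fixes f :: "'a::euclidean_space \<Rightarrow> real"
  assumes diff: "\<And>x. f differentiable (at x)" and lip: "L-lipschitz_on UNIV (gradient f)"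
  shows "\<bar>f (x + d) - f x - gradient f x \<bullet> d\<bar> \<le> L * (norm d)\<^sup>2"
proof -
  define \<phi> where "\<phi> t = f (x + t *\<^sub>R d)" for t :: real
  have \<phi>': "(\<phi> has_derivative (\<lambda>s. (s *\<^sub>R d) \<bullet> gradient f (x + t *\<^sub>R d))) (at t)" for t
    unfolding \<phi>_def
    by (rule has_derivative_compose[where g = f, OF _ GDERIV_gradient[OF diff, unfolded gderiv_def]])
       (auto intro!: derivative_eq_intros)
  obtain t where t: "0 < t" "t < 1" "\<phi> 1 - \<phi> 0 = (1 *\<^sub>R d) \<bullet> gradient f (x + t *\<^sub>R d)"
    using mvt_simple[of 0 1 \<phi>, OF _ has_derivative_at_withinI[OF \<phi>']]
    by (auto simp: greaterThanLessThan_iff)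
  have "f (x + d) - f x - gradient f x \<bullet> d = (gradient f (x + t *\<^sub>R d) - gradient f x) \<bullet> d"
    using t(3) by (simp add: \<phi>_def inner_diff_left inner_commute[of d])
  also have "\<bar>\<dots>\<bar> \<le> norm (gradient f (x + t *\<^sub>R d) - gradient f x) * norm d"
    by (rule Cauchy_Schwarz_ineq2)
  also have "\<dots> \<le> (L * norm d) * norm d"
  proof (rule mult_right_mono)
    have "norm (gradient f (x + t *\<^sub>R d) - gradient f x) \<le> L * norm (t *\<^sub>R d)"
      using lipschitz_onD[OF lip, of "x + t *\<^sub>R d" x] by (simp add: dist_norm)
    also have "\<dots> \<le> L * norm d"
      using t lipschitz_on_nonneg[OF lip] by (auto intro!: mult_left_mono mult_left_le_one_le)
    finally show "norm (gradient f (x + t *\<^sub>R d) - gradient f x) \<le> L * norm d" .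
  qed simp
  finally show ?thesis by (simp add: power2_eq_square mult.assoc)
qed

subsection \<open>Frobenius and spectral norm\<close>

lemma norm_matrix_squared:
  "(norm (A :: real^'n^'m))\<^sup>2 = (\<Sum>i\<in>UNIV. \<Sum>j\<in>UNIV. (A $ i $ j)\<^sup>2)"
  unfolding power2_norm_eq_inner by (simp add: inner_vec_def power2_eq_square)

lemma norm_matrix_squared_columns:
  "(norm (A :: real^'n^'m))\<^sup>2 = (\<Sum>j\<in>UNIV. (norm (column j A))\<^sup>2)"
  unfolding norm_matrix_squared
  unfolding power2_norm_eq_inner
  by (subst sum.swap) (simp add: inner_vec_def column_def power2_eq_square)

lemma norm_transpose: "norm (transpose (A :: real^'n^'m)) = norm A"
proof -
  have "(norm (transpose A))\<^sup>2 = (norm A)\<^sup>2"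
    unfolding norm_matrix_squared by (subst sum.swap) (simp add: transpose_def)
  then show ?thesis by simp
qed

lemma norm_matrix_vector_mult_le: "norm ((A :: real^'n^'m) *v x) \<le> norm A * norm x"
proof (rule power2_le_imp_le)
  have "(norm (A *v x))\<^sup>2 = (\<Sum>i\<in>UNIV. (A $ i \<bullet> x)\<^sup>2)"
    unfolding power2_norm_eq_inner
    by (simp add: inner_vec_def matrix_vector_mult_def power2_eq_square)
  also have "\<dots> \<le> (\<Sum>i\<in>UNIV. (norm (A $ i))\<^sup>2 * (norm x)\<^sup>2)"
    by (intro sum_mono) (simp add: Cauchy_Schwarz_ineq power2_norm_eq_inner)
  also have "\<dots> = (norm A * norm x)\<^sup>2"
    unfolding power_mult_distrib sum_distrib_right[symmetric]
    by (simp add: power2_norm_eq_inner inner_vec_def)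
  finally show "(norm (A *v x))\<^sup>2 \<le> (norm A * norm x)\<^sup>2" .
qed simp

text \<open>Column \<open>j\<close> of the product is \<open>A\<close> applied to column
  \<open>j\<close> of \<open>B\<close>, so the matrix-vector bound sums over the columns.\<close>

lemma norm_matrix_mult_le:
  "norm ((A :: real^'k^'m) ** (B :: real^'n^'k)) \<le> norm A * norm B"
proof (rule power2_le_imp_le)
  have "(norm (A ** B))\<^sup>2 = (\<Sum>j\<in>UNIV. (norm (A *v column j B))\<^sup>2)"
    unfolding norm_matrix_squared_columns
    by (simp add: column_def matrix_matrix_mult_def matrix_vector_mult_def)
  also have "\<dots> \<le> (\<Sum>j\<in>UNIV. (norm A)\<^sup>2 * (norm (column j B))\<^sup>2)"
    unfolding power_mult_distrib[symmetric]
    by (intro sum_mono power_mono norm_matrix_vector_mult_le) simp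
  also have "\<dots> = (norm A * norm B)\<^sup>2"
    by (simp add: norm_matrix_squared_columns[of B] power_mult_distrib sum_distrib_left)
  finally show "(norm (A ** B))\<^sup>2 \<le> (norm A * norm B)\<^sup>2" .
qed simp

lemma spectral_norm_nonneg: "0 \<le> spectral_norm A"
  unfolding spectral_norm_def by (rule onorm_pos_le) simp

lemma spectral_norm_le_norm: "spectral_norm A \<le> norm A"
  unfolding spectral_norm_def by (rule onorm_le) (rule norm_matrix_vector_mult_le)

text \<open>Subadditivity and domination by the Frobenius norm make the spectral norm 1-Lipschitz,
  hence continuous.\<close>

lemma borel_measurable_spectral_norm [measurable]: "spectral_norm \<in> borel_measurable borel"
proof (rule borel_measurable_continuous_onI)
  have le: "spectral_norm A \<le> spectral_norm B + norm (A - B)" for A B :: "real^'n^'m"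
  proof -
    have "spectral_norm A = onorm (\<lambda>x. B *v x + (A - B) *v x)"
      unfolding spectral_norm_def by (simp add: matrix_vector_mult_diff_rdistrib)
    also have "\<dots> \<le> spectral_norm B + spectral_norm (A - B)"
      unfolding spectral_norm_def by (rule onorm_triangle) auto
    finally show ?thesis using spectral_norm_le_norm[of "A - B"] by simp
  qed
  have "dist (spectral_norm A) (spectral_norm B) \<le> 1 * dist A B" for A B :: "real^'n^'m"
    using le[of A B] le[of B A] by (simp add: dist_norm abs_le_iff norm_minus_commute)
  then have "1-lipschitz_on UNIV (spectral_norm :: real^'n^'m \<Rightarrow> real)"
    by (intro lipschitz_onI) auto
  then show "continuous_on UNIV (spectral_norm :: real^'n^'m \<Rightarrow> real)"
    by (rule lipschitz_on_continuous_on)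
qed

subsection \<open>Truncated singular value decompositions\<close>

lemma inner_outer_product:
  "(\<chi> a b. u $ a * v $ b) \<bullet> ((\<chi> a b. u' $ a * v' $ b) :: real^'n^'m) = (u \<bullet> u') * (v \<bullet> v')"
  by (simp add: inner_vec_def sum_product algebra_simps)

text \<open>The rank-one terms of an SVD are pairwise orthogonal for the Frobenius inner product, so
  only the common indices of the two truncations contribute.\<close>

lemma inner_svd_truncation:
  fixes G :: "real^'n^'m"
  assumes svd: "is_svd G \<sigma> u v"
  shows "(\<chi> a b. \<Sum>i<p. \<sigma> i * u i $ a * v i $ b) \<bullet> ((\<chi> a b. \<Sum>i<r. \<sigma> i * u i $ a * v i $ b) :: real^'n^'m)
    = (\<Sum>i<min p r. (\<sigma> i)\<^sup>2)"
proof -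
  define q where "q = min CARD('m) CARD('n)"
  define O' where "O' i = ((\<chi> a b. u i $ a * v i $ b) :: real^'n^'m)" for i
  have trunc: "(\<chi> a b. \<Sum>i<k. \<sigma> i * u i $ a * v i $ b) = (\<Sum>i<k. \<sigma> i *\<^sub>R O' i)" for k
    by (simp add: O'_def vec_eq_iff mult.assoc)
  \<comment> \<open>Vectors of index \<open>q\<close> or more need not be orthonormal, but their
    singular values vanish, so the relation holds for all \<open>i\<close> and
    \<open>j\<close>.\<close>
  have orth: "(\<sigma> i *\<^sub>R O' i) \<bullet> (\<sigma> j *\<^sub>R O' j) = (if i = j then (\<sigma> i)\<^sup>2 else 0)" for i j
    using svd unfolding is_svd_def Let_def q_def[symmetric] O'_def inner_scaleR_left
      inner_scaleR_right inner_outer_product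
    by (cases "i < q"; cases "j < q") (auto simp: power2_eq_square)
  have "(\<Sum>i<p. \<sigma> i *\<^sub>R O' i) \<bullet> (\<Sum>j<r. \<sigma> j *\<^sub>R O' j)
      = (\<Sum>i<p. \<Sum>j<r. if i = j then (\<sigma> i)\<^sup>2 else 0)"
    by (simp only: inner_sum_left inner_sum_right orth) (rule sum.swap)
  also have "\<dots> = (\<Sum>i<p. if i < r then (\<sigma> i)\<^sup>2 else 0)"
    by (intro sum.cong) auto
  also have "\<dots> = (\<Sum>i<min p r. (\<sigma> i)\<^sup>2)"
    by (rule sum.mono_neutral_cong_right) auto
  finally show ?thesis by (simp only: trunc)
qed

lemma norm_svd_squared:
  fixes G :: "real^'n^'m"
  assumes "is_svd G \<sigma> u v"
  shows "(norm G)\<^sup>2 = (\<Sum>i<min CARD('m) CARD('n). (\<sigma> i)\<^sup>2)"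
proof -
  have "G = (\<chi> a b. \<Sum>i<min CARD('m) CARD('n). \<sigma> i * u i $ a * v i $ b)"
    using assms by (simp add: is_svd_def Let_def)
  then show ?thesis
    using inner_svd_truncation[OF assms, of "min CARD('m) CARD('n)" "min CARD('m) CARD('n)"]
    by (simp add: power2_norm_eq_inner)
qed

text \<open>The square of the largest singular value is one of the terms of the squared Frobenius
  norm; there is such a term because both dimensions are positive.\<close>

lemma singular_value_le_norm:
  fixes G :: "real^'n^'m"
  assumes svd: "is_svd G \<sigma> u v"
  shows "\<sigma> i \<le> norm G"
proof (rule power2_le_imp_le)
  have "\<sigma> i \<le> \<sigma> 0" "0 \<le> \<sigma> i"
    using svd by (auto simp: is_svd_def Let_def antimono_def)
  then have "(\<sigma> i)\<^sup>2 \<le> (\<sigma> 0)\<^sup>2" by (rule power_mono)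
  also have "\<dots> \<le> (norm G)\<^sup>2"
    unfolding norm_svd_squared[OF svd] by (rule member_le_sum) auto
  finally show "(\<sigma> i)\<^sup>2 \<le> (norm G)\<^sup>2" .
qed simp

text \<open>Truncation discards squares from the sum that equals \<open>(norm G)\<^sup>2\<close>;
  for ranks beyond \<open>q\<close> the additional squares are 0.\<close>

lemma norm_truncated_svd_le:
  assumes "is_truncated_svd r G Q"
  shows "norm Q \<le> norm (G :: real^'n^'m)"
proof (rule power2_le_imp_le)
  define q where "q = min CARD('m) CARD('n)"
  obtain \<sigma> u v where svd: "is_svd G \<sigma> u v" and Q: "Q = (\<chi> a b. \<Sum>i<r. \<sigma> i * u i $ a * v i $ b)"
    using assms by (auto simp: is_truncated_svd_def)
  have "(norm Q)\<^sup>2 = (\<Sum>i<r. (\<sigma> i)\<^sup>2)"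
    using inner_svd_truncation[OF svd, of r r] by (simp add: Q power2_norm_eq_inner)
  also have "\<dots> = (\<Sum>i<min r q. (\<sigma> i)\<^sup>2)"
    using svd by (intro sum.mono_neutral_right) (auto simp: is_svd_def Let_def q_def)
  also have "\<dots> \<le> (norm G)\<^sup>2"
    unfolding norm_svd_squared[OF svd] q_def by (rule sum_mono2) auto
  finally show "(norm Q)\<^sup>2 \<le> (norm G)\<^sup>2" .
qed simp

text \<open>The inner product keeps at least the largest squared singular value, and the squared
  norm of \<open>G\<close> is at most \<open>q\<close> times that value. Hence the projected
  gradient is a descent direction for every rank, even rank 1.\<close>

lemma inner_truncated_svd_ge:
  assumes "is_truncated_svd r (G :: real^'n^'m) Q" "r \<ge> 1"
  shows "(norm G)\<^sup>2 \<le> real (min CARD('m) CARD('n)) * (G \<bullet> Q)"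
proof -
  define q where "q = min CARD('m) CARD('n)"
  obtain \<sigma> u v where svd: "is_svd G \<sigma> u v" and Q: "Q = (\<chi> a b. \<Sum>i<r. \<sigma> i * u i $ a * v i $ b)"
    using assms by (auto simp: is_truncated_svd_def)
  have G: "G = (\<chi> a b. \<Sum>i<q. \<sigma> i * u i $ a * v i $ b)"
    using svd by (simp add: is_svd_def Let_def q_def)
  have "q \<ge> 1" by (simp add: q_def Suc_le_eq)
  have "(norm G)\<^sup>2 \<le> (\<Sum>i<q. (\<sigma> 0)\<^sup>2)"
    unfolding norm_svd_squared[OF svd] q_def[symmetric]
    using svd by (intro sum_mono power_mono) (auto simp: is_svd_def Let_def antimono_def)
  also have "\<dots> = q * (\<sigma> 0)\<^sup>2" by simp
  also have "(\<sigma> 0)\<^sup>2 \<le> (\<Sum>i<min q r. (\<sigma> i)\<^sup>2)"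
    using \<open>q \<ge> 1\<close> assms(2) by (intro member_le_sum) auto
  also have "\<dots> = G \<bullet> Q"
    unfolding Q by (subst (1) G) (rule inner_svd_truncation[OF svd, symmetric])
  finally show ?thesis by (simp add: q_def mult_left_mono)
qed

section \<open>Size and product of the restart factors\<close>

lemma matrix_mult_diagonal:
  "(A :: real^'r^'m) ** (\<chi> i j. if i = j then d i else 0) = (\<chi> i j. A $ i $ j * d j)"
  by (simp add: matrix_matrix_mult_def vec_eq_iff if_distrib[of "\<lambda>x. _ * x"] cong: if_cong)

lemma norm_matrix_mult_diagonal:
  "(norm ((A :: real^'r^'m) ** (\<chi> i j. if i = j then d i else 0)))\<^sup>2
    = (\<Sum>j\<in>UNIV. (d j)\<^sup>2 * (norm (column j A))\<^sup>2)"
  unfolding norm_matrix_squared_columns matrix_mult_diagonal power2_norm_eq_inner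
  by (simp add: column_def inner_vec_def sum_distrib_left power2_eq_square algebra_simps)

text \<open>The singular values are split evenly between the factors: \<open>D ** D\<close> is
  \<open>\<Lambda>\<close>, which gives the product. Up to the factor \<open>\<eta>\<close>, each of
  the \<open>CARD('r)\<close> columns of the left factor, and likewise each row of the right one,
  has squared length at most a singular value, hence at most \<open>norm G\<close>.\<close>

lemma lora_restart_factors:
  fixes X :: "('m::finite, 'r::finite, 'n::finite) factors"
  assumes restart: "lora_restart P \<eta> G X" and "\<eta> \<ge> 0"
  shows "fst X ** snd X = - \<eta> *\<^sub>R P G"
    and "(norm (fst X))\<^sup>2 \<le> \<eta> * CARD('r) * norm G"
    and "(norm (snd X))\<^sup>2 \<le> \<eta> * CARD('r) * norm G"
proof -
  obtain U :: "real^'r^'m" and \<Lambda> V where top: "is_top_svd (- G) U \<Lambda> V"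
    and P: "U ** \<Lambda> ** transpose V = - P G"
    and A: "fst X = sqrt \<eta> *\<^sub>R (U ** (\<chi> i j. sqrt (\<Lambda> $ i $ j)))"
    and B: "snd X = sqrt \<eta> *\<^sub>R ((\<chi> i j. sqrt (\<Lambda> $ i $ j)) ** transpose V)"
    using restart by (auto simp: lora_restart_def)
  obtain \<sigma> u v e where svd: "is_svd (- G) \<sigma> u v"
    and U: "\<And>j. column j U = u (e j)" and V: "\<And>j. column j V = v (e j)"
    and \<Lambda>: "\<Lambda> = (\<chi> i j. if i = j then \<sigma> (e i) else 0)"
    using top by (auto simp: is_top_svd_def)
  define D :: "real^'r^'r" where "D = (\<chi> i j. if i = j then sqrt (\<sigma> (e i)) else 0)"
  have \<sigma>: "0 \<le> \<sigma> i" for i using svd by (simp add: is_svd_def Let_def)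
  have D: "(\<chi> i j. sqrt (\<Lambda> $ i $ j)) = D"
    by (simp add: \<Lambda> D_def vec_eq_iff)
  have DD: "D ** D = \<Lambda>"
    unfolding D_def matrix_mult_diagonal \<Lambda> by (auto simp: vec_eq_iff \<sigma>)
  have "fst X ** snd X = (sqrt \<eta> * sqrt \<eta>) *\<^sub>R (U ** (D ** D) ** transpose V)"
    unfolding A B D
    by (simp add: matrix_mul_assoc scalar_matrix_assoc matrix_scalar_ac flip: scalar_mult_eq_scaleR)
  then show "fst X ** snd X = - \<eta> *\<^sub>R P G"
    using \<open>\<eta> \<ge> 0\<close> by (simp add: DD P)
  \<comment> \<open>A generic \<open>Z\<close> serves both \<open>U\<close> and \<open>V\<close>. A
    column with \<open>e j\<close> beyond the genuine indices may have any length, but it is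
    multiplied by a zero singular value.\<close>
  have norm_D: "(norm (Z ** D))\<^sup>2 \<le> CARD('r) * norm G"
    if "\<And>j. e j < min CARD('m) CARD('n) \<Longrightarrow> norm (column j Z) = 1" for Z :: "real^'r^'k"
  proof -
    have "(norm (Z ** D))\<^sup>2 = (\<Sum>j\<in>UNIV. \<sigma> (e j) * (norm (column j Z))\<^sup>2)"
      unfolding D_def norm_matrix_mult_diagonal by (simp add: \<sigma>)
    also have "\<dots> \<le> (\<Sum>j\<in>(UNIV :: 'r set). norm G)"
    proof (rule sum_mono)
      fix j
      show "\<sigma> (e j) * (norm (column j Z))\<^sup>2 \<le> norm G"
      proof (cases "e j < min CARD('m) CARD('n)")
        case True
        then show ?thesis using that[of j] singular_value_le_norm[OF svd, of "e j"] by simp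
      next
        case False
        then have "\<sigma> (e j) = 0" using svd unfolding is_svd_def Let_def not_less by blast
        then show ?thesis by simp
      qed
    qed
    finally show ?thesis by simp
  qed
  have "norm (column j U) = 1" "norm (column j V) = 1" if "e j < min CARD('m) CARD('n)" for j
    using svd that by (simp_all add: U V is_svd_def Let_def norm_eq_1)
  then have UD: "(norm (U ** D))\<^sup>2 \<le> CARD('r) * norm G"
    and VD: "(norm (V ** D))\<^sup>2 \<le> CARD('r) * norm G"
    by (auto intro!: norm_D)
  show "(norm (fst X))\<^sup>2 \<le> \<eta> * CARD('r) * norm G"
    using mult_left_mono[OF UD \<open>\<eta> \<ge> 0\<close>] \<open>\<eta> \<ge> 0\<close> by (simp add: A D power_mult_distrib algebra_simps)
  have "transpose D = D"
    by (simp add: D_def transpose_def vec_eq_iff)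
  then have "norm (D ** transpose V) = norm (V ** D)"
    by (metis matrix_transpose_mul norm_transpose)
  then show "(norm (snd X))\<^sup>2 \<le> \<eta> * CARD('r) * norm G"
    using mult_left_mono[OF VD \<open>\<eta> \<ge> 0\<close>] \<open>\<eta> \<ge> 0\<close> by (simp add: B D power_mult_distrib algebra_simps)
qed

subsection \<open>Adam steps\<close>

text \<open>Unrolled, the second moment contains the squared gradient of step \<open>j\<close> with
  weight \<open>(1 - \<beta>2) * \<beta>2 ^ (t - j)\<close>; the weaker exponent \<open>t\<close>
  makes the bound uniform in \<open>j\<close>.\<close>

lemma adam_v_ge:
  assumes "0 < \<beta>2" "\<beta>2 < 1" "1 \<le> j" "j \<le> t"
  shows "(1 - \<beta>2) * \<beta>2 ^ t * (g j $ a $ b)\<^sup>2 \<le> adam_v \<beta>2 g t $ a $ b"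
  using assms(4)
proof (induction t)
  case 0
  then show ?case using \<open>1 \<le> j\<close> by simp
next
  case (Suc t)
  have nonneg: "0 \<le> adam_v \<beta>2 g k $ a $ b" for k
    using assms(1,2) by (induction k) auto
  show ?case
  proof (cases "j = Suc t")
    case True
    have "\<beta>2 ^ Suc t \<le> 1" using assms by (intro power_le_one) auto
    then have "(1 - \<beta>2) * \<beta>2 ^ Suc t * (g j $ a $ b)\<^sup>2 \<le> (1 - \<beta>2) * 1 * (g j $ a $ b)\<^sup>2"
      using assms by (intro mult_right_mono mult_left_mono) auto
    then show ?thesis using nonneg[of t] assms True by (simp add: add_increasing)
  next
    case False
    then have "\<beta>2 * ((1 - \<beta>2) * \<beta>2 ^ t * (g j $ a $ b)\<^sup>2) \<le> \<beta>2 * adam_v \<beta>2 g t $ a $ b"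
      using Suc assms by (intro mult_left_mono) auto
    moreover have "0 \<le> (1 - \<beta>2) * (g (Suc t) $ a $ b)\<^sup>2" using assms by simp
    ultimately show ?thesis by (simp add: algebra_simps)
  qed
qed

text \<open>Because the recursion starts at 0, the first moment is a combination of the gradients
  with nonnegative weights of sum at most 1.\<close>

lemma adam_m_abs_le:
  assumes "\<And>j. 1 \<le> j \<Longrightarrow> j \<le> t \<Longrightarrow> 0 \<le> \<beta>1 j \<and> \<beta>1 j \<le> 1"
    and "\<And>j. 1 \<le> j \<Longrightarrow> j \<le> t \<Longrightarrow> \<bar>g j $ a $ b\<bar> \<le> B" and "0 \<le> B"
  shows "\<bar>adam_m \<beta>1 g t $ a $ b\<bar> \<le> B"
  using assms(1,2)
proof (induction t)
  case 0
  then show ?case using \<open>0 \<le> B\<close> by simp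
next
  case (Suc t)
  have \<beta>: "0 \<le> \<beta>1 (Suc t)" "\<beta>1 (Suc t) \<le> 1" using Suc.prems(1)[of "Suc t"] by auto
  have "\<bar>adam_m \<beta>1 g (Suc t) $ a $ b\<bar>
      \<le> \<bar>\<beta>1 (Suc t) * adam_m \<beta>1 g t $ a $ b\<bar> + \<bar>(1 - \<beta>1 (Suc t)) * g (Suc t) $ a $ b\<bar>"
    by simp
  also have "\<dots> \<le> \<beta>1 (Suc t) * B + (1 - \<beta>1 (Suc t)) * B"
    unfolding abs_mult using \<beta> Suc by (intro add_mono mult_mono) auto
  finally show ?case by (simp add: algebra_simps)
qed

text \<open>The factor \<open>1 - \<beta>1bar\<close> bounds the bias correction of the first moment
  from below; the root comes from \<open>adam_v_ge\<close> at \<open>t = K\<close>, the worst step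
  of a cycle.\<close>

definition adam_step_bound :: "real \<Rightarrow> real \<Rightarrow> nat \<Rightarrow> real" where
  "adam_step_bound \<beta>1bar \<beta>2 K = 1 / ((1 - \<beta>1bar) * sqrt ((1 - \<beta>2) * \<beta>2 ^ K))"

lemma adam_step_bound_nonneg: "\<beta>1bar < 1 \<Longrightarrow> 0 < \<beta>2 \<Longrightarrow> \<beta>2 < 1 \<Longrightarrow> 0 \<le> adam_step_bound \<beta>1bar \<beta>2 K"
  by (simp add: adam_step_bound_def)

text \<open>The second moment controls each of the finitely many past gradients, so the bound holds
  whatever the gradients are.\<close>

lemma adam_direction_le:
  assumes beta2: "0 < \<beta>2" "\<beta>2 < 1" and "eps > 0"
    and beta1: "\<beta>1bar < 1" "\<And>t. t \<ge> 1 \<Longrightarrow> 0 \<le> \<beta>1 t \<and> \<beta>1 t \<le> \<beta>1bar"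
    and t: "1 \<le> t" "t \<le> K"
  shows "\<bar>adam_m_hat \<beta>1 g t $ a $ b / (sqrt (adam_v_hat \<beta>2 g t $ a $ b) + eps)\<bar>
    \<le> adam_step_bound \<beta>1bar \<beta>2 K"
proof -
  define \<kappa> where "\<kappa> = (1 - \<beta>2) * \<beta>2 ^ K"
  define y where "y = adam_v \<beta>2 g t $ a $ b"
  have \<kappa>: "0 < \<kappa>" using beta2 by (simp add: \<kappa>_def)
  have "\<beta>2 ^ K \<le> \<beta>2 ^ t" using beta2 t by (intro power_decreasing) auto
  then have \<kappa>_le: "\<kappa> \<le> (1 - \<beta>2) * \<beta>2 ^ t" using beta2 by (simp add: \<kappa>_def mult_left_mono)
  \<comment> \<open>The current second moment dominates every gradient seen so far, so the first
    moment is at most a multiple of its root.\<close>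
  have g_le: "\<bar>g j $ a $ b\<bar> \<le> sqrt y / sqrt \<kappa>" if "1 \<le> j" "j \<le> t" for j
  proof -
    have "\<kappa> * (g j $ a $ b)\<^sup>2 \<le> (1 - \<beta>2) * \<beta>2 ^ t * (g j $ a $ b)\<^sup>2"
      using \<kappa>_le by (rule mult_right_mono) simp
    also have "\<dots> \<le> y"
      unfolding y_def by (rule adam_v_ge[OF beta2 that])
    finally have "(g j $ a $ b)\<^sup>2 \<le> y / \<kappa>" using \<kappa> by (simp add: field_simps)
    then show ?thesis by (metis real_sqrt_abs real_sqrt_divide real_sqrt_le_iff)
  qed
  have "0 \<le> (1 - \<beta>2) * \<beta>2 ^ t * (g 1 $ a $ b)\<^sup>2" using beta2 by simp
  also have "\<dots> \<le> y" unfolding y_def using t by (intro adam_v_ge[OF beta2]) auto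
  finally have y: "0 \<le> y" .
  have \<beta>1: "0 \<le> \<beta>1 j \<and> \<beta>1 j \<le> 1" if "1 \<le> j" for j
    using beta1(1) beta1(2)[OF that] by simp
  have m: "\<bar>adam_m \<beta>1 g t $ a $ b\<bar> \<le> sqrt y / sqrt \<kappa>"
    using \<beta>1 g_le y \<kappa> by (intro adam_m_abs_le) auto
  \<comment> \<open>The last factor is at most \<open>\<beta>1bar\<close> and the others are at most
    1, which keeps the bias correction away from 0.\<close>
  have "(\<Prod>j=1..t. \<beta>1 j) = (\<Prod>j=1..t-1. \<beta>1 j) * \<beta>1 t"
    using t by (cases t) auto
  also have "\<dots> \<le> 1 * \<beta>1bar"
    using beta1(2) \<beta>1 t by (intro mult_mono prod_le_1) auto
  finally have prod: "1 - \<beta>1bar \<le> 1 - (\<Prod>j=1..t. \<beta>1 j)" by simp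
  have "\<bar>adam_m_hat \<beta>1 g t $ a $ b\<bar> = \<bar>adam_m \<beta>1 g t $ a $ b\<bar> / (1 - (\<Prod>j=1..t. \<beta>1 j))"
    using prod beta1 by (simp add: adam_m_hat_def abs_mult)
  also have "\<dots> \<le> (sqrt y / sqrt \<kappa>) / (1 - \<beta>1bar)"
    using m prod beta1 y \<kappa> by (intro frac_le) auto
  finally have m_hat: "\<bar>adam_m_hat \<beta>1 g t $ a $ b\<bar> \<le> adam_step_bound \<beta>1bar \<beta>2 K * sqrt y"
    by (simp add: adam_step_bound_def \<kappa>_def field_simps)
  \<comment> \<open>Bias correction divides by a number in (0,1], so it can only enlarge the second
    moment.\<close>
  have "\<beta>2 ^ t < 1" using beta2 t by (simp add: power_less_one_iff)
  then have "y \<le> adam_v_hat \<beta>2 g t $ a $ b"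
    using y beta2 by (simp add: adam_v_hat_def y_def[symmetric] field_simps)
  then have v_hat: "sqrt y \<le> sqrt (adam_v_hat \<beta>2 g t $ a $ b)" by simp
  with y have pos: "0 < sqrt (adam_v_hat \<beta>2 g t $ a $ b) + eps"
    using \<open>eps > 0\<close> by (meson add_nonneg_pos order_trans real_sqrt_ge_zero)
  have "\<bar>adam_m_hat \<beta>1 g t $ a $ b\<bar>
      \<le> adam_step_bound \<beta>1bar \<beta>2 K * (sqrt (adam_v_hat \<beta>2 g t $ a $ b) + eps)"
    using m_hat v_hat \<open>eps > 0\<close> adam_step_bound_nonneg[OF beta1(1) beta2, of K]
    by (smt (verit) mult_left_mono)
  then show ?thesis using pos by (simp add: abs_divide pos_divide_le_eq)
qed

lemma norm_matrix_le_entries: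
  fixes A :: "real^'n^'m" and c :: real
  assumes "\<And>i j. \<bar>A $ i $ j\<bar> \<le> c"
  shows "norm A \<le> CARD('m) * CARD('n) * c"
proof -
  have "norm A \<le> (\<Sum>i\<in>UNIV. norm (A $ i))"
    unfolding norm_vec_def[of A] by (rule L2_set_le_sum) simp
  also have "\<dots> \<le> (\<Sum>i\<in>(UNIV::'m set). \<Sum>j\<in>(UNIV::'n set). \<bar>A $ i $ j\<bar>)"
    by (intro sum_mono norm_le_l1_cart)
  also have "\<dots> \<le> (\<Sum>i\<in>(UNIV::'m set). \<Sum>j\<in>(UNIV::'n set). c)"
    by (intro sum_mono assms)
  finally show ?thesis by (simp add: mult.assoc)
qed

text \<open>Triangle inequality over \<open>t\<close> steps; the product of cardinalities converts
  the entrywise bound of \<open>adam_direction_le\<close> into a Frobenius bound.\<close>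

lemma adam_displacement_le:
  fixes x0 :: "real^'b^'a"
  assumes beta2: "0 < \<beta>2" "\<beta>2 < 1" and "eps > 0"
    and beta1: "\<beta>1bar < 1" "\<And>t. t \<ge> 1 \<Longrightarrow> 0 \<le> \<beta>1 t \<and> \<beta>1 t \<le> \<beta>1bar"
    and alpha: "\<And>j. 1 \<le> j \<Longrightarrow> j \<le> K \<Longrightarrow> 0 \<le> \<alpha> j \<and> \<alpha> j \<le> \<alpha>max"
    and t: "t \<le> K"
  shows "norm (adam_iterate \<alpha> \<beta>1 \<beta>2 eps x0 g t - x0)
    \<le> t * (\<alpha>max * (CARD('a) * CARD('b) * adam_step_bound \<beta>1bar \<beta>2 K))"
  using t
proof (induction t)
  case (Suc t)
  define d where "d = ((\<chi> i j. adam_m_hat \<beta>1 g (Suc t) $ i $ j /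
      (sqrt (adam_v_hat \<beta>2 g (Suc t) $ i $ j) + eps)) :: real^'b^'a)"
  have d: "norm d \<le> CARD('a) * CARD('b) * adam_step_bound \<beta>1bar \<beta>2 K"
    unfolding d_def using Suc.prems
    by (intro norm_matrix_le_entries) (simp only: vec_lambda_beta, intro adam_direction_le assms, auto)
  have "norm (\<alpha> (Suc t) *\<^sub>R d) \<le> \<alpha>max * (CARD('a) * CARD('b) * adam_step_bound \<beta>1bar \<beta>2 K)"
    using alpha[of "Suc t"] Suc.prems d by (auto intro!: mult_mono intro: order_trans)
  moreover have "norm (adam_iterate \<alpha> \<beta>1 \<beta>2 eps x0 g (Suc t) - x0)
      \<le> norm (adam_iterate \<alpha> \<beta>1 \<beta>2 eps x0 g t - x0) + norm (\<alpha> (Suc t) *\<^sub>R d)"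
    unfolding adam_iterate.simps d_def[symmetric]
    using norm_triangle_ineq4[of "adam_iterate \<alpha> \<beta>1 \<beta>2 eps x0 g t - x0" "\<alpha> (Suc t) *\<^sub>R d"]
    by (simp add: algebra_simps)
  ultimately show ?case
    using Suc by (simp add: algebra_simps)
qed simp

section \<open>Measurability of the Adam iterates\<close>

lemma borel_measurable_matrix_iff:
  fixes f :: "'w \<Rightarrow> real^'n^'m"
  shows "f \<in> borel_measurable M \<longleftrightarrow> (\<forall>i j. (\<lambda>x. f x $ i $ j) \<in> borel_measurable M)"
proof
  assume "f \<in> borel_measurable M"
  then show "\<forall>i j. (\<lambda>x. f x $ i $ j) \<in> borel_measurable M"
    by (auto intro!: borel_measurable_continuous_on[of "\<lambda>A. A $ _ $ _"] continuous_intros)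
next
  assume "\<forall>i j. (\<lambda>x. f x $ i $ j) \<in> borel_measurable M"
  then show "f \<in> borel_measurable M"
    by (subst borel_measurable_euclidean_space) (auto simp: Basis_vec_def inner_axis)
qed

lemma borel_measurable_matrix_mult [measurable (raw)]:
  fixes A :: "'w \<Rightarrow> real^'k^'m" and B :: "'w \<Rightarrow> real^'n^'k"
  assumes "A \<in> borel_measurable M" "B \<in> borel_measurable M"
  shows "(\<lambda>x. A x ** B x) \<in> borel_measurable M"
  using assms unfolding borel_measurable_matrix_iff matrix_matrix_mult_def
  by (auto intro!: borel_measurable_sum borel_measurable_times)

text \<open>Only the gradients up to step \<open>t\<close> enter, which matters for a last cycle
  that is cut off by the horizon.\<close>

lemma borel_measurable_adam_iterate:
  fixes x0 :: "'w \<Rightarrow> real^'b^'a"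
  assumes x0: "x0 \<in> borel_measurable M"
    and g: "\<And>j. 1 \<le> j \<Longrightarrow> j \<le> t \<Longrightarrow> g j \<in> borel_measurable M"
  shows "(\<lambda>x. adam_iterate \<alpha> \<beta>1 \<beta>2 eps (x0 x) (\<lambda>j. g j x) t) \<in> borel_measurable M"
proof -
  have g': "(\<lambda>x. g j x $ a $ b) \<in> borel_measurable M" if "1 \<le> j" "j \<le> t" for j a b
    using g[OF that] by (simp add: borel_measurable_matrix_iff)
  have m: "(\<lambda>x. adam_m \<beta>1 (\<lambda>j. g j x) k $ a $ b) \<in> borel_measurable M" if "k \<le> t" for k a b
    using that by (induction k) (auto intro!: borel_measurable_add borel_measurable_times g')
  have v: "(\<lambda>x. adam_v \<beta>2 (\<lambda>j. g j x) k $ a $ b) \<in> borel_measurable M" if "k \<le> t" for k a b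
    using that
    by (induction k) (auto intro!: borel_measurable_add borel_measurable_times borel_measurable_power g')
  have "(\<lambda>x. adam_iterate \<alpha> \<beta>1 \<beta>2 eps (x0 x) (\<lambda>j. g j x) k $ a $ b) \<in> borel_measurable M"
    if "k \<le> t" for k a b
    using that
  proof (induction k)
    case 0
    then show ?case using x0 by (simp add: borel_measurable_matrix_iff)
  next
    case (Suc k)
    have [measurable]: "(\<lambda>x. adam_m \<beta>1 (\<lambda>j. g j x) (Suc k) $ a $ b) \<in> borel_measurable M"
      "(\<lambda>x. adam_v \<beta>2 (\<lambda>j. g j x) (Suc k) $ a $ b) \<in> borel_measurable M"
      "(\<lambda>x. adam_iterate \<alpha> \<beta>1 \<beta>2 eps (x0 x) (\<lambda>j. g j x) k $ a $ b) \<in> borel_measurable M"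
      using Suc m[of "Suc k" a b] v[of "Suc k" a b] by auto
    have "(\<lambda>x. adam_iterate \<alpha> \<beta>1 \<beta>2 eps (x0 x) (\<lambda>j. g j x) k $ a $ b
        - \<alpha> (Suc k) * ((1 / (1 - (\<Prod>j=1..Suc k. \<beta>1 j))) * adam_m \<beta>1 (\<lambda>j. g j x) (Suc k) $ a $ b
          / (sqrt ((1 / (1 - \<beta>2 ^ Suc k)) * adam_v \<beta>2 (\<lambda>j. g j x) (Suc k) $ a $ b) + eps)))
        \<in> borel_measurable M"
      by measurable
    then show ?case
      by (simp add: adam_m_hat_def adam_v_hat_def del: adam_m.simps adam_v.simps)
  qed
  then show ?thesis by (simp add: borel_measurable_matrix_iff)
qed

subsection \<open>Square integrability and conditional expectation\<close>

definition square_integrable :: "'w measure \<Rightarrow> ('w \<Rightarrow> 'a::euclidean_space) \<Rightarrow> bool" where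
  "square_integrable M f \<longleftrightarrow> f \<in> borel_measurable M \<and> integrable M (\<lambda>x. (norm (f x))\<^sup>2)"

lemma norm_add_squared_le: "(norm (x + y))\<^sup>2 \<le> 2 * (norm x)\<^sup>2 + 2 * (norm (y :: 'a::real_inner))\<^sup>2"
proof -
  have "(norm (x + y))\<^sup>2 + (norm (x - y))\<^sup>2 = 2 * (norm x)\<^sup>2 + 2 * (norm y)\<^sup>2"
    by (simp add: power2_norm_eq_inner inner_simps inner_commute)
  then show ?thesis by (smt (verit) zero_le_power2)
qed

lemma abs_inner_le_squares: "\<bar>x \<bullet> y\<bar> \<le> (norm x)\<^sup>2 + (norm (y :: 'a::real_inner))\<^sup>2"
proof -
  have "2 * (norm x * norm y) \<le> (norm x)\<^sup>2 + (norm y)\<^sup>2"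
    using sum_squares_bound[of "norm x" "norm y"] by simp
  moreover have "\<bar>x \<bullet> y\<bar> \<le> norm x * norm y" by (rule Cauchy_Schwarz_ineq2)
  moreover have "0 \<le> norm x * norm y" by simp
  ultimately show ?thesis by linarith
qed

context prob_space
begin

text \<open>Constants are integrable on a probability space, so a growth bound of the form
  \<open>a * (1 + (norm (f x))\<^sup>2)\<close> suffices as a dominating function.\<close>

lemma square_integrable_bound:
  assumes "square_integrable M f" "g \<in> borel_measurable M"
    and "\<And>x. x \<in> space M \<Longrightarrow> (norm (g x))\<^sup>2 \<le> a * (1 + (norm (f x))\<^sup>2)"
  shows "square_integrable M g"
proof -
  have "integrable M (\<lambda>x. a * (1 + (norm (f x))\<^sup>2))"
    using assms(1) by (auto simp: square_integrable_def)
  then have "integrable M (\<lambda>x. (norm (g x))\<^sup>2)"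
    by (rule Bochner_Integration.integrable_bound)
       (use assms in \<open>auto intro!: AE_I2 order_trans[OF _ abs_ge_self]\<close>)
  with assms(2) show ?thesis by (simp add: square_integrable_def)
qed

lemma square_integrable_add:
  assumes "square_integrable M f" "square_integrable M g"
  shows "square_integrable M (\<lambda>x. f x + g x)"
proof -
  have "integrable M (\<lambda>x. 2 * (norm (f x))\<^sup>2 + 2 * (norm (g x))\<^sup>2)"
    using assms by (auto simp: square_integrable_def)
  then have "integrable M (\<lambda>x. (norm (f x + g x))\<^sup>2)"
    by (rule Bochner_Integration.integrable_bound)
       (use assms in \<open>auto simp: square_integrable_def intro!: AE_I2 norm_add_squared_le\<close>)
  with assms show ?thesis by (auto simp: square_integrable_def)
qed

lemma integrable_inner:
  assumes "square_integrable M f" "square_integrable M g"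
  shows "integrable M (\<lambda>x. f x \<bullet> g x)"
proof -
  have "integrable M (\<lambda>x. (norm (f x))\<^sup>2 + (norm (g x))\<^sup>2)"
    using assms by (auto simp: square_integrable_def)
  then show ?thesis
    by (rule Bochner_Integration.integrable_bound)
       (use assms in \<open>auto simp: square_integrable_def abs_inner_le_squares intro!: AE_I2\<close>)
qed

lemma sigma_finite_subalgebraI: "subalgebra M F \<Longrightarrow> sigma_finite_subalgebra M F"
  by (intro finite_measure_subalgebra_is_sigma_finite finite_measure_subalgebra.intro
      finite_measure_subalgebra_axioms.intro finite_measure_axioms)

lemma borel_measurable_vec_cond_exp: "vec_cond_exp M F Z \<in> borel_measurable F"
  unfolding vec_cond_exp_def[abs_def] by measurable

lemma square_integrable_inner_left:
  assumes "square_integrable M f"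
  shows "square_integrable M (\<lambda>x. f x \<bullet> b)"
proof (rule square_integrable_bound[OF assms])
  show "(\<lambda>x. f x \<bullet> b) \<in> borel_measurable M"
    using assms by (auto simp: square_integrable_def)
  show "(norm (f x \<bullet> b))\<^sup>2 \<le> (norm b)\<^sup>2 * (1 + (norm (f x))\<^sup>2)" for x
  proof -
    have "(norm (f x \<bullet> b))\<^sup>2 \<le> (norm (f x))\<^sup>2 * (norm b)\<^sup>2"
      unfolding power2_norm_eq_inner[of "f x"] power2_norm_eq_inner[of b] real_norm_def power2_abs
      by (rule Cauchy_Schwarz_ineq)
    also have "\<dots> \<le> (norm b)\<^sup>2 * (1 + (norm (f x))\<^sup>2)"
      by (simp add: distrib_left mult.commute)
    finally show ?thesis .
  qed
qed

text \<open>Coordinate by coordinate, the \<open>F\<close>-measurable factor moves inside the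
  conditional expectation; square integrability of both factors makes each product
  integrable.\<close>

lemma expectation_inner_cond_exp:
  assumes F: "subalgebra M F" and D_F: "D \<in> borel_measurable F"
    and D: "square_integrable M D" and Z: "square_integrable M Z"
  shows "integrable M (\<lambda>x. D x \<bullet> vec_cond_exp M F Z x)"
    and "(\<integral>x. D x \<bullet> vec_cond_exp M F Z x \<partial>M) = (\<integral>x. D x \<bullet> Z x \<partial>M)"
proof -
  interpret sigma_finite_subalgebra M F by (rule sigma_finite_subalgebraI[OF F])
  have DZ: "integrable M (\<lambda>x. (D x \<bullet> b) * (Z x \<bullet> b))" for b
    using integrable_inner[OF square_integrable_inner_left[OF D] square_integrable_inner_left[OF Z]]
    by simp
  have [measurable]: "(\<lambda>x. D x \<bullet> b) \<in> borel_measurable F" for b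
    using D_F by measurable
  have [measurable]: "(\<lambda>x. Z x \<bullet> b) \<in> borel_measurable M" for b
    using Z by (auto simp: square_integrable_def)
  note cond = real_cond_exp_intg[OF DZ]
  have eq: "D x \<bullet> vec_cond_exp M F Z x
      = (\<Sum>b\<in>Basis. (D x \<bullet> b) * real_cond_exp M F (\<lambda>y. Z y \<bullet> b) x)" for x
    by (simp add: vec_cond_exp_def inner_sum_right mult.commute)
  show "integrable M (\<lambda>x. D x \<bullet> vec_cond_exp M F Z x)"
    unfolding eq by (intro Bochner_Integration.integrable_sum cond(1)) measurable
  have "(\<integral>x. D x \<bullet> vec_cond_exp M F Z x \<partial>M) = (\<Sum>b\<in>Basis. \<integral>x. (D x \<bullet> b) * (Z x \<bullet> b) \<partial>M)"
    unfolding eq by (subst Bochner_Integration.integral_sum) (auto simp: cond)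
  also have "\<dots> = (\<integral>x. (\<Sum>b\<in>Basis. (D x \<bullet> b) * (Z x \<bullet> b)) \<partial>M)"
    by (rule Bochner_Integration.integral_sum[symmetric]) (rule DZ)
  finally show "(\<integral>x. D x \<bullet> vec_cond_exp M F Z x \<partial>M) = (\<integral>x. D x \<bullet> Z x \<partial>M)"
    by (simp add: euclidean_inner[symmetric])
qed

text \<open>The conditional mean is \<open>D\<close> almost everywhere, so integrating the
  conditional variance against the test function 1 gives the second moment of the error around
  \<open>D\<close>. Working in \<open>ennreal\<close> yields integrability together with the
  bound.\<close>

lemma stochastic_gradient_variance:
  assumes F: "subalgebra M F" "subalgebra M F'" and "C \<ge> 0"
    and sg: "stochastic_gradient M F F' Y D C" and D: "D \<in> borel_measurable M"
  shows "integrable M (\<lambda>x. (norm (Y x - D x))\<^sup>2)"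
    and "(\<integral>x. (norm (Y x - D x))\<^sup>2 \<partial>M) \<le> C"
proof -
  interpret sigma_finite_subalgebra M F by (rule sigma_finite_subalgebraI[OF F(1)])
  have [measurable]: "Y \<in> borel_measurable M"
    using sg measurable_from_subalg[OF F(2)] by (auto simp: stochastic_gradient_def)
  have [measurable]: "vec_cond_exp M F Y \<in> borel_measurable M"
    by (rule measurable_from_subalg[OF F(1) borel_measurable_vec_cond_exp])
  have "(\<integral>\<^sup>+x. ennreal ((norm (Y x - D x))\<^sup>2) \<partial>M)
      = (\<integral>\<^sup>+x. 1 * ennreal ((norm (Y x - vec_cond_exp M F Y x))\<^sup>2) \<partial>M)"
    using sg by (intro nn_integral_cong_AE) (auto simp: stochastic_gradient_def)
  also have "\<dots> = (\<integral>\<^sup>+x. 1 * cond_variance M F Y x \<partial>M)"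
    unfolding cond_variance_def by (rule nn_cond_exp_intg[symmetric]) auto
  also have "\<dots> \<le> (\<integral>\<^sup>+x. ennreal C \<partial>M)"
    using sg by (intro nn_integral_mono_AE) (auto simp: stochastic_gradient_def)
  also have "\<dots> = ennreal C" by (simp add: emeasure_space_1)
  finally have le: "(\<integral>\<^sup>+x. ennreal ((norm (Y x - D x))\<^sup>2) \<partial>M) \<le> ennreal C" .
  show "integrable M (\<lambda>x. (norm (Y x - D x))\<^sup>2)"
    using D le by (intro integrableI_nonneg) (auto intro: le_less_trans)
  show "(\<integral>x. (norm (Y x - D x))\<^sup>2 \<partial>M) \<le> C"
    using \<open>C \<ge> 0\<close> le by (rule integral_real_bounded)
qed

lemma square_integrable_stochastic_gradient:
  assumes F: "subalgebra M F" "subalgebra M F'" and "C \<ge> 0"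
    and sg: "stochastic_gradient M F F' Y D C" and D: "square_integrable M D"
  shows "square_integrable M Y"
proof -
  have [measurable]: "D \<in> borel_measurable M" "Y \<in> borel_measurable M"
    using D sg measurable_from_subalg[OF F(2)]
    by (auto simp: stochastic_gradient_def square_integrable_def)
  have "square_integrable M (\<lambda>x. Y x - D x)"
    using stochastic_gradient_variance(1)[OF F \<open>C \<ge> 0\<close> sg] by (simp add: square_integrable_def)
  from square_integrable_add[OF this D] show ?thesis by simp
qed

end

subsection \<open>Descent over one cycle\<close>

lemma young_inequality:
  fixes x y a :: real
  assumes "0 < a"
  shows "x * y \<le> a * x\<^sup>2 + y\<^sup>2 / (4 * a)"
proof -
  have "0 \<le> a * (x - y / (2 * a))\<^sup>2" using assms by simp
  also have "\<dots> = a * x\<^sup>2 - x * y + y\<^sup>2 / (4 * a)"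
    using assms by (simp add: power2_eq_square field_simps)
  finally show ?thesis by simp
qed

text \<open>Expand around \<open>A0\<close> and \<open>B0\<close>: these have order
  \<open>sqrt (h * y)\<close> and the displacements have order \<open>h^2\<close>. The mixed terms
  thus have squared norm of order \<open>h^5 * y\<close>, and the product of the displacements has
  order \<open>h^8\<close>.\<close>

lemma matrix_mult_perturbation:
  fixes A A0 :: "real^'r^'m" and B B0 :: "real^'n^'r"
  assumes A0: "(norm A0)\<^sup>2 \<le> h * r * y" and B0: "(norm B0)\<^sup>2 \<le> h * r * y"
    and A: "norm (A - A0) \<le> c * h\<^sup>2" and B: "norm (B - B0) \<le> c * h\<^sup>2"
    and h: "0 \<le> h" "h \<le> 1" and "0 \<le> r" "0 \<le> y"
  shows "(norm (A ** B - A0 ** B0))\<^sup>2 \<le> (8 * c\<^sup>2 * r + 2 * c ^ 4) * h ^ 5 * (1 + y\<^sup>2)"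
proof -
  \<comment> \<open>The sign of \<open>c * h^2\<close> is read off from its being an upper bound of
    a norm.\<close>
  have c: "0 \<le> c * h\<^sup>2" using A norm_ge_zero order_trans by blast
  have "A ** B - A0 ** B0 = A0 ** (B - B0) + (A - A0) ** B0 + (A - A0) ** (B - B0)"
    by (simp add: matrix_matrix_mult_def vec_eq_iff sum_subtractf[symmetric] sum.distrib[symmetric]
        algebra_simps)
  then have "norm (A ** B - A0 ** B0)
      \<le> norm (A0 ** (B - B0)) + norm ((A - A0) ** B0) + norm ((A - A0) ** (B - B0))"
    by (simp add: norm_add_rule_thm)
  also have "\<dots> \<le> norm A0 * (c * h\<^sup>2) + (c * h\<^sup>2) * norm B0 + (c * h\<^sup>2) * (c * h\<^sup>2)"
    using A B c
    by (intro add_mono order_trans[OF norm_matrix_mult_le] mult_mono) auto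
  also have "\<dots> = c * h\<^sup>2 * (norm A0 + norm B0) + (c * h\<^sup>2)\<^sup>2"
    by (simp add: power2_eq_square algebra_simps)
  finally have "(norm (A ** B - A0 ** B0))\<^sup>2 \<le> (c * h\<^sup>2 * (norm A0 + norm B0) + (c * h\<^sup>2)\<^sup>2)\<^sup>2"
    by (rule power_mono) simp
  also have "\<dots> \<le> 2 * (c * h\<^sup>2 * (norm A0 + norm B0))\<^sup>2 + 2 * ((c * h\<^sup>2)\<^sup>2)\<^sup>2"
    using norm_add_squared_le[of "c * h\<^sup>2 * (norm A0 + norm B0)" "(c * h\<^sup>2)\<^sup>2"] by simp
  also have "(c * h\<^sup>2 * (norm A0 + norm B0))\<^sup>2 \<le> (c * h\<^sup>2)\<^sup>2 * (4 * (h * r * y))"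
  proof -
    have "(norm A0 + norm B0)\<^sup>2 \<le> 4 * (h * r * y)"
      using norm_add_squared_le[of "norm A0" "norm B0"] A0 B0 by simp
    then show ?thesis unfolding power_mult_distrib[of _ "norm A0 + norm B0"] by (intro mult_left_mono) auto
  qed
  also have "2 * ((c * h\<^sup>2)\<^sup>2 * (4 * (h * r * y))) + 2 * ((c * h\<^sup>2)\<^sup>2)\<^sup>2
      = 8 * c\<^sup>2 * r * h ^ 5 * y + 2 * c ^ 4 * h ^ 8 * 1"
    by (simp add: power2_eq_square eval_nat_numeral algebra_simps)
  also have "\<dots> \<le> 8 * c\<^sup>2 * r * h ^ 5 * (1 + y\<^sup>2) + 2 * c ^ 4 * h ^ 5 * (1 + y\<^sup>2)"
  proof (intro add_mono mult_mono)
    show "y \<le> 1 + y\<^sup>2" using young_inequality[of 1 y 1] by simp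
    show "h ^ 8 \<le> h ^ 5" using h by (intro power_decreasing) auto
  qed (use assms in auto)
  finally show ?thesis by (simp add: algebra_simps)
qed

text \<open>The move is the projected step plus the remainder \<open>z\<close>, whose squared norm
  is \<open>O(h^5)\<close>. Young's inequality trades the inner product of gradient and remainder
  for a small multiple of the squared gradient and a term \<open>O(h^4)\<close>; smoothness adds
  \<open>L * (norm d)\<^sup>2\<close>, which is \<open>O(h^2)\<close>.\<close>

lemma perturbed_descent:
  fixes l :: "'a::euclidean_space \<Rightarrow> real"
  assumes diff: "\<And>x. l differentiable (at x)" and lip: "L-lipschitz_on UNIV (gradient l)"
    and e: "(norm (d + h *\<^sub>R p))\<^sup>2 \<le> \<kappa> * h ^ 5 * (1 + (norm y)\<^sup>2)"
    and p: "norm p \<le> norm y" and h: "0 < h" "h \<le> 1" and q: "0 < q" and \<kappa>: "0 \<le> \<kappa>"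
  shows "(norm d)\<^sup>2 \<le> (2 + 2 * \<kappa>) * h\<^sup>2 * (1 + (norm y)\<^sup>2)"
    and "l (w + d) \<le> l w - h * (gradient l w \<bullet> p) + h / (8 * q) * (norm (gradient l w))\<^sup>2
      + (2 * q * \<kappa> + L * (2 + 2 * \<kappa>)) * h\<^sup>2 * (1 + (norm y)\<^sup>2)"
proof -
  define Q where "Q = 1 + (norm y)\<^sup>2"
  define z where "z = d + h *\<^sub>R p"
  have Q: "0 \<le> Q" by (simp add: Q_def)
  have L: "0 \<le> L" using lip by (rule lipschitz_on_nonneg)
  have z: "(norm z)\<^sup>2 \<le> \<kappa> * h ^ 5 * Q" using e by (simp add: z_def Q_def)
  have "h ^ 5 \<le> h\<^sup>2" using h by (intro power_decreasing) auto
  then have "\<kappa> * h ^ 5 * Q \<le> \<kappa> * h\<^sup>2 * Q" using \<kappa> Q by (intro mult_right_mono mult_left_mono) auto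
  with z have z2: "(norm z)\<^sup>2 \<le> \<kappa> * h\<^sup>2 * Q" by simp
  have "(norm p)\<^sup>2 \<le> Q" using power_mono[OF p norm_ge_zero, of 2] unfolding Q_def by linarith
  then have hp: "(norm (- (h *\<^sub>R p)))\<^sup>2 \<le> h\<^sup>2 * Q" by (simp add: power_mult_distrib mult_left_mono)
  have "(norm d)\<^sup>2 \<le> 2 * (norm z)\<^sup>2 + 2 * (norm (- (h *\<^sub>R p)))\<^sup>2"
    using norm_add_squared_le[of z "- (h *\<^sub>R p)"] by (simp add: z_def)
  then have d: "(norm d)\<^sup>2 \<le> (2 + 2 * \<kappa>) * h\<^sup>2 * Q"
    using z2 hp by (simp add: algebra_simps)
  then show "(norm d)\<^sup>2 \<le> (2 + 2 * \<kappa>) * h\<^sup>2 * (1 + (norm y)\<^sup>2)" by (simp add: Q_def)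
  have "gradient l w \<bullet> z \<le> norm (gradient l w) * norm z" by (rule norm_cauchy_schwarz)
  \<comment> \<open>The weight is a quarter of the \<open>h / (2 * q)\<close> that the projected
    step supplies in expectation. Dividing by it costs one power of \<open>h\<close>.\<close>
  also have "\<dots> \<le> h / (8 * q) * (norm (gradient l w))\<^sup>2 + (norm z)\<^sup>2 / (4 * (h / (8 * q)))"
    using h q by (intro young_inequality) auto
  also have "(norm z)\<^sup>2 / (4 * (h / (8 * q))) \<le> (\<kappa> * h ^ 5 * Q) / (4 * (h / (8 * q)))"
    using z h q by (intro divide_right_mono) auto
  also have "\<dots> = 2 * q * \<kappa> * Q * h ^ 4"
    using h q by (simp add: field_simps eval_nat_numeral)
  also have "\<dots> \<le> 2 * q * \<kappa> * Q * h\<^sup>2"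
    using h q \<kappa> Q by (intro mult_left_mono power_decreasing) auto
  finally have Gz: "gradient l w \<bullet> z \<le> h / (8 * q) * (norm (gradient l w))\<^sup>2 + 2 * q * \<kappa> * Q * h\<^sup>2"
    by simp
  have "l (w + d) \<le> l w + gradient l w \<bullet> d + L * (norm d)\<^sup>2"
    using lipschitz_gradient_taylor[OF diff lip, of w d] by linarith
  also have "gradient l w \<bullet> d = gradient l w \<bullet> z - h * (gradient l w \<bullet> p)"
    by (simp add: z_def inner_add_right)
  also have "L * (norm d)\<^sup>2 \<le> L * ((2 + 2 * \<kappa>) * h\<^sup>2 * Q)" using d L by (rule mult_left_mono)
  finally show "l (w + d) \<le> l w - h * (gradient l w \<bullet> p) + h / (8 * q) * (norm (gradient l w))\<^sup>2
      + (2 * q * \<kappa> + L * (2 + 2 * \<kappa>)) * h\<^sup>2 * (1 + (norm y)\<^sup>2)"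
    using Gz by (simp add: Q_def algebra_simps)
qed

lemma borel_measurable_lipschitz_gradient:
  assumes "L-lipschitz_on UNIV (gradient l)"
  shows "gradient l \<in> borel_measurable borel"
  using assms by (intro borel_measurable_continuous_onI lipschitz_on_continuous_on)

context prob_space
begin

text \<open>A Lipschitz map grows at most linearly; the comparison point is 0.\<close>

lemma square_integrable_gradient:
  fixes l :: "'b::euclidean_space \<Rightarrow> real"
  assumes lip: "L-lipschitz_on UNIV (gradient l)" and w: "square_integrable M w"
  shows "square_integrable M (\<lambda>x. gradient l (w x))"
proof (rule square_integrable_bound[OF w])
  note [measurable] = borel_measurable_lipschitz_gradient[OF lip]
  have [measurable]: "w \<in> borel_measurable M" using w by (simp add: square_integrable_def)
  show "(\<lambda>x. gradient l (w x)) \<in> borel_measurable M" by measurable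
  define b where "b = 2 * (norm (gradient l 0))\<^sup>2"
  show "(norm (gradient l (w x)))\<^sup>2 \<le> (b + 2 * L\<^sup>2) * (1 + (norm (w x))\<^sup>2)" for x
  proof -
    have "norm (gradient l (w x) - gradient l 0) \<le> L * norm (w x)"
      using lipschitz_onD[OF lip, of "w x" 0] by (simp add: dist_norm)
    then have "(norm (gradient l (w x) - gradient l 0))\<^sup>2 \<le> (L * norm (w x))\<^sup>2"
      by (rule power_mono) simp
    then have "(norm (gradient l (w x)))\<^sup>2 \<le> b + 2 * (L\<^sup>2 * (norm (w x))\<^sup>2)"
      using norm_add_squared_le[of "gradient l 0" "gradient l (w x) - gradient l 0"]
      by (simp add: b_def power_mult_distrib)
    also have "\<dots> \<le> (b + 2 * L\<^sup>2) * (1 + (norm (w x))\<^sup>2)"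
      by (simp add: b_def algebra_simps)
    finally show ?thesis .
  qed
qed

text \<open>The first-order expansion at 0 shows that the loss grows at most quadratically.\<close>

lemma integrable_loss:
  fixes l :: "'b::euclidean_space \<Rightarrow> real"
  assumes diff: "\<And>x. l differentiable (at x)" and lip: "L-lipschitz_on UNIV (gradient l)"
    and w: "square_integrable M w"
  shows "integrable M (\<lambda>x. l (w x))"
proof -
  have [measurable]: "w \<in> borel_measurable M" using w by (simp add: square_integrable_def)
  have "continuous_on UNIV l"
    using diff by (intro differentiable_imp_continuous_on) (auto simp: differentiable_on_def intro: differentiable_at_withinI)
  then have [measurable]: "l \<in> borel_measurable borel" by (rule borel_measurable_continuous_onI)
  have "integrable M (\<lambda>x. \<bar>l 0\<bar> + (norm (gradient l 0))\<^sup>2 + (1 + L) * (norm (w x))\<^sup>2)"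
    using w by (auto simp: square_integrable_def)
  then show ?thesis
  proof (rule Bochner_Integration.integrable_bound)
    have "\<bar>l (w x)\<bar> \<le> \<bar>l 0\<bar> + (norm (gradient l 0))\<^sup>2 + (1 + L) * (norm (w x))\<^sup>2" for x
      using lipschitz_gradient_taylor[OF diff lip, of 0 "w x"] abs_inner_le_squares[of "gradient l 0" "w x"]
      by (simp add: algebra_simps)
    then show "AE x in M. norm (l (w x)) \<le> norm (\<bar>l 0\<bar> + (norm (gradient l 0))\<^sup>2 + (1 + L) * (norm (w x))\<^sup>2)"
      by (intro AE_I2) (auto intro: order_trans[OF _ abs_ge_self])
  qed measurable
qed

text \<open>In conditional mean, \<open>p\<close> is within \<open>err\<close> of the projected
  gradient, which gives a decrease of \<open>h / (2 * q)\<close> times the mean squared gradient, up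
  to the bias. The remainder in \<open>perturbed_descent\<close> and the second moment of
  \<open>Y\<close> each take back \<open>h / (8 * q)\<close>, leaving
  \<open>h / (4 * q)\<close>.\<close>

lemma expected_descent:
  fixes l :: "'b::euclidean_space \<Rightarrow> real"
  assumes F: "subalgebra M F" "subalgebra M F'" and C: "0 \<le> C"
    and sg: "stochastic_gradient M F F' Y (\<lambda>x. gradient l (w x)) C"
    and diff: "\<And>x. l differentiable (at x)" and lip: "L-lipschitz_on UNIV (gradient l)"
    and w: "square_integrable M w" and p: "p \<in> borel_measurable M" and d: "d \<in> borel_measurable M"
    and p_le: "\<And>x. x \<in> space M \<Longrightarrow> norm (p x) \<le> norm (Y x)"
    and e: "\<And>x. x \<in> space M \<Longrightarrow> (norm (d x + h *\<^sub>R p x))\<^sup>2 \<le> \<kappa> * h ^ 5 * (1 + (norm (Y x))\<^sup>2)"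
    and bias: "AE x in M. norm (vec_cond_exp M F p x - P (gradient l (w x))) \<le> err"
    and P: "\<And>G. (norm G)\<^sup>2 \<le> q * (G \<bullet> P G)" and q: "0 < q" and \<kappa>: "0 \<le> \<kappa>"
    and h: "0 < h" "h \<le> 1" and h_small: "16 * q * (2 * q * \<kappa> + L * (2 + 2 * \<kappa>)) * h \<le> 1"
  shows "h / (4 * q) * (\<integral>x. (norm (gradient l (w x)))\<^sup>2 \<partial>M) + (\<integral>x. l (w x + d x) \<partial>M)
    \<le> (\<integral>x. l (w x) \<partial>M) + q / 2 * (h * err\<^sup>2)
      + (2 * q * \<kappa> + L * (2 + 2 * \<kappa>)) * (1 + 2 * C) * h\<^sup>2"
proof -
  define c where "c = 2 * q * \<kappa> + L * (2 + 2 * \<kappa>)"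
  have c: "0 \<le> c" using q \<kappa> lipschitz_on_nonneg[OF lip] by (simp add: c_def)
  define G where "G x = gradient l (w x)" for x
  define N where "N = (\<integral>x. (norm (G x))\<^sup>2 \<partial>M)"
  note sg = sg[folded G_def]
  have G: "square_integrable M G"
    unfolding G_def by (rule square_integrable_gradient[OF lip w])
  then have [measurable]: "G \<in> borel_measurable M" by (simp add: square_integrable_def)
  have Y: "square_integrable M Y"
    by (rule square_integrable_stochastic_gradient[OF F C sg G])
  have p2: "square_integrable M p"
    by (rule square_integrable_bound[OF Y p, where a = 1])
       (use power_mono[OF p_le, of _ 2] in \<open>auto intro: add_increasing\<close>)
  have d2: "square_integrable M d"
    by (rule square_integrable_bound[OF Y d])
       (rule perturbed_descent(1)[OF diff lip e p_le h q \<kappa>])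
  have wd: "square_integrable M (\<lambda>x. w x + d x)"
    by (rule square_integrable_add[OF w d2])
  have var: "integrable M (\<lambda>x. (norm (Y x - G x))\<^sup>2)" "(\<integral>x. (norm (Y x - G x))\<^sup>2 \<partial>M) \<le> C"
    using stochastic_gradient_variance[OF F C sg] by simp_all

  \<comment> \<open>The conditional expectation of \<open>Y\<close> is an
    \<open>F\<close>-measurable version of the gradient at \<open>w\<close>; this lets
    \<open>p\<close> be replaced by its conditional expectation inside the inner product.\<close>
  define D where "D = vec_cond_exp M F Y"
  have DG: "AE x in M. D x = G x"
    using sg by (simp add: stochastic_gradient_def D_def)
  have D_F: "D \<in> borel_measurable F"
    unfolding D_def by (rule borel_measurable_vec_cond_exp)
  have [measurable]: "D \<in> borel_measurable M" by (rule measurable_from_subalg[OF F(1) D_F])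
  have "integrable M (\<lambda>x. (norm (D x))\<^sup>2) \<longleftrightarrow> integrable M (\<lambda>x. (norm (G x))\<^sup>2)"
    using DG by (intro integrable_cong_AE) auto
  then have D2: "square_integrable M D" using G by (simp add: square_integrable_def)
  have Dp: "integrable M (\<lambda>x. D x \<bullet> vec_cond_exp M F p x)"
    "(\<integral>x. D x \<bullet> vec_cond_exp M F p x \<partial>M) = (\<integral>x. D x \<bullet> p x \<partial>M)"
    using expectation_inner_cond_exp[OF F(1) D_F D2 p2] by auto
  have inner_lower: "N / (2 * q) - q * err\<^sup>2 / 2 \<le> (\<integral>x. G x \<bullet> p x \<partial>M)"
  proof -
    have "AE x in M. (norm (G x))\<^sup>2 / (2 * q) - q * err\<^sup>2 / 2 \<le> D x \<bullet> vec_cond_exp M F p x"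
      using DG bias
    proof eventually_elim
      fix x assume D: "D x = G x"
        and b: "norm (vec_cond_exp M F p x - P (gradient l (w x))) \<le> err"
      let ?Z = "vec_cond_exp M F p x"
      have "G x \<bullet> (P (G x) - ?Z) \<le> norm (G x) * norm (P (G x) - ?Z)" by (rule norm_cauchy_schwarz)
      also have "\<dots> \<le> norm (G x) * err"
        using b by (intro mult_left_mono) (auto simp: G_def norm_minus_commute)
      \<comment> \<open>With this weight the bias consumes half of the lower bound
        \<open>(norm (G x))\<^sup>2 / q\<close> that comes from \<open>P\<close>.\<close>
      also have "\<dots> \<le> 1 / (2 * q) * (norm (G x))\<^sup>2 + err\<^sup>2 / (4 * (1 / (2 * q)))"
        using q by (intro young_inequality) simp
      finally have "G x \<bullet> P (G x) - (norm (G x))\<^sup>2 / (2 * q) - q * err\<^sup>2 / 2 \<le> G x \<bullet> ?Z"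
        by (simp add: inner_diff_right mult.commute)
      moreover have "(norm (G x))\<^sup>2 / q \<le> G x \<bullet> P (G x)"
        using P[of "G x"] q by (simp add: field_simps)
      moreover have "(norm (G x))\<^sup>2 / q = 2 * ((norm (G x))\<^sup>2 / (2 * q))" by simp
      ultimately show "(norm (G x))\<^sup>2 / (2 * q) - q * err\<^sup>2 / 2 \<le> D x \<bullet> ?Z"
        unfolding D by linarith
    qed
    then have "(\<integral>x. (norm (G x))\<^sup>2 / (2 * q) - q * err\<^sup>2 / 2 \<partial>M)
        \<le> (\<integral>x. D x \<bullet> vec_cond_exp M F p x \<partial>M)"
      using G Dp(1) by (intro integral_mono_AE) (auto simp: square_integrable_def)
    also have "(\<integral>x. D x \<bullet> vec_cond_exp M F p x \<partial>M) = (\<integral>x. G x \<bullet> p x \<partial>M)"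
      unfolding Dp(2) using DG p by (intro integral_cong_AE) auto
    also have "(\<integral>x. (norm (G x))\<^sup>2 / (2 * q) - q * err\<^sup>2 / 2 \<partial>M) = N / (2 * q) - q * err\<^sup>2 / 2"
      using G by (simp add: square_integrable_def N_def prob_space)
    finally show ?thesis .
  qed

  have int: "integrable M (\<lambda>x. G x \<bullet> p x)" "integrable M (\<lambda>x. (norm (G x))\<^sup>2)"
    "integrable M (\<lambda>x. l (w x))" "integrable M (\<lambda>x. l (w x + d x))"
    using integrable_inner[OF G p2] G integrable_loss[OF diff lip w] integrable_loss[OF diff lip wd]
    by (auto simp: square_integrable_def)
  have "(\<integral>x. l (w x + d x) \<partial>M) \<le> (\<integral>x. l (w x) - h * (G x \<bullet> p x) + h / (8 * q) * (norm (G x))\<^sup>2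
      + c * h\<^sup>2 * (1 + (2 * (norm (G x))\<^sup>2 + 2 * (norm (Y x - G x))\<^sup>2)) \<partial>M)"
  proof (rule integral_mono)
    fix x assume x: "x \<in> space M"
    have "l (w x + d x) \<le> l (w x) - h * (G x \<bullet> p x) + h / (8 * q) * (norm (G x))\<^sup>2
        + c * h\<^sup>2 * (1 + (norm (Y x))\<^sup>2)"
      unfolding G_def c_def by (rule perturbed_descent(2)[OF diff lip e[OF x] p_le[OF x] h q \<kappa>])
    \<comment> \<open>The estimate is split into gradient and noise; the noise part has expectation
      at most \<open>C\<close>.\<close>
    also have "c * h\<^sup>2 * (1 + (norm (Y x))\<^sup>2)
        \<le> c * h\<^sup>2 * (1 + (2 * (norm (G x))\<^sup>2 + 2 * (norm (Y x - G x))\<^sup>2))"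
      using c norm_add_squared_le[of "G x" "Y x - G x"] by (intro mult_left_mono) auto
    finally show "l (w x + d x) \<le> l (w x) - h * (G x \<bullet> p x) + h / (8 * q) * (norm (G x))\<^sup>2
      + c * h\<^sup>2 * (1 + (2 * (norm (G x))\<^sup>2 + 2 * (norm (Y x - G x))\<^sup>2))" by simp
  qed (use int var in auto)
  also have "\<dots> = (\<integral>x. l (w x) \<partial>M) - h * (\<integral>x. G x \<bullet> p x \<partial>M) + h / (8 * q) * N
      + c * h\<^sup>2 * (1 + (2 * N + 2 * (\<integral>x. (norm (Y x - G x))\<^sup>2 \<partial>M)))"
    using int var by (simp add: N_def prob_space)
  also have "\<dots> \<le> (\<integral>x. l (w x) \<partial>M) - h * (N / (2 * q) - q * err\<^sup>2 / 2) + h / (8 * q) * N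
      + c * h\<^sup>2 * (1 + (2 * N + 2 * C))"
    using inner_lower var(2) h c q by (intro add_mono diff_mono mult_left_mono) auto
  also have "c * h\<^sup>2 * (1 + (2 * N + 2 * C)) = (2 * c * h) * (h * N) + c * (1 + 2 * C) * h\<^sup>2"
    by (simp add: power2_eq_square algebra_simps)
  \<comment> \<open>The gradient part of the second moment carries one more power of
    \<open>h\<close> than the descent term, so it is absorbed for small \<open>h\<close>;
    \<open>h_small\<close> is exactly the condition for this.\<close>
  also have "(2 * c * h) * (h * N) \<le> 1 / (8 * q) * (h * N)"
  proof (rule mult_right_mono)
    show "2 * c * h \<le> 1 / (8 * q)" using h_small q by (simp add: c_def field_simps)
    show "0 \<le> h * N" using h by (simp add: N_def)
  qed
  also have "(\<integral>x. l (w x) \<partial>M) - h * (N / (2 * q) - q * err\<^sup>2 / 2) + h / (8 * q) * N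
      + (1 / (8 * q) * (h * N) + c * (1 + 2 * C) * h\<^sup>2)
    = (\<integral>x. l (w x) \<partial>M) - h / (4 * q) * N + q / 2 * (h * err\<^sup>2) + c * (1 + 2 * C) * h\<^sup>2"
    using q by (simp add: field_simps)
  finally show ?thesis
    by (simp add: c_def N_def G_def)
qed

end

subsection \<open>A single run\<close>

text \<open>The horizon \<open>T\<close> is fixed here. Adam enters only through measurability and
  the displacement bound \<open>c * h\<^sup>2\<close>. The constants \<open>L\<close>,
  \<open>C\<close>, \<open>E\<close>, \<open>c\<close>, \<open>q\<close> and \<open>\<rho>\<close>
  can be chosen once for all horizons, so bounds stated in them are uniform in
  \<open>T\<close>.\<close>

locale peso_run = prob_space M for M :: "'w measure" +
  fixes l :: "real^'n^'m \<Rightarrow> real" and W0 :: "real^'n^'m" and P :: "real^'n^'m \<Rightarrow> real^'n^'m"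
    and L C E c h q \<rho> :: real and K T :: nat and err :: "nat \<Rightarrow> real"
    and H R :: "nat \<Rightarrow> 'w measure" and Gt :: "nat \<Rightarrow> 'w \<Rightarrow> real^'n^'m"
    and X :: "'w \<Rightarrow> nat \<Rightarrow> nat \<Rightarrow> ('m, 'r::finite, 'n) factors"
  assumes K: "1 \<le> K" "K \<le> T" and h_def: "h = 1 / sqrt (real (T div K))"
    and q_def: "q = real (min CARD('m) CARD('n))" and \<rho>_def: "\<rho> = real CARD('r)"
    and P: "\<And>G. is_truncated_svd CARD('r) G (P G)"
    and hist: "histories M H R"
    and X_measurable: "\<And>s t. restart_step K s \<le> T \<Longrightarrow> t \<le> K \<Longrightarrow> s * K + t \<le> T \<Longrightarrow>
      (\<lambda>\<omega>. fst (X \<omega> s t)) \<in> borel_measurable M \<and> (\<lambda>\<omega>. snd (X \<omega> s t)) \<in> borel_measurable M"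
    and restart: "\<And>s \<omega>. restart_step K s \<le> T \<Longrightarrow> \<omega> \<in> space M \<Longrightarrow>
      lora_restart P h (Gt (restart_step K s) \<omega>) (X \<omega> s 0)"
    and displacement: "\<And>s t \<omega>. t \<le> K \<Longrightarrow> norm (fst (X \<omega> s t) - fst (X \<omega> s 0)) \<le> c * h\<^sup>2 \<and>
      norm (snd (X \<omega> s t) - snd (X \<omega> s 0)) \<le> c * h\<^sup>2"
    and bounded_below: "bdd_below (range l)" and diff: "\<And>x. l differentiable (at x)"
    and lip: "L-lipschitz_on UNIV (gradient l)" and C: "0 \<le> C"
    and full_gradients: "\<And>k. 1 \<le> k \<Longrightarrow> k \<le> T \<Longrightarrow>
      stochastic_gradient M (H k) (R k) (Gt k) (\<lambda>\<omega>. gradient l (weight K W0 (X \<omega>) k)) C"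
    and projection_error: "\<And>k. 1 \<le> k \<Longrightarrow> k \<le> T \<Longrightarrow> (k - 1) mod K = 0 \<Longrightarrow>
      AE \<omega> in M. norm (vec_cond_exp M (H k) (\<lambda>\<omega>. P (Gt k \<omega>)) \<omega>
        - P (gradient l (weight K W0 (X \<omega>) k))) \<le> err k"
    and error_sum: "(\<Sum>k | 1 \<le> k \<and> k \<le> T \<and> (k - 1) mod K = 0. h * (err k)\<^sup>2) \<le> E"
begin

abbreviation anchored :: "nat \<Rightarrow> 'w \<Rightarrow> real^'n^'m" where
  "anchored s \<omega> \<equiv> anchor K W0 (X \<omega>) s"

abbreviation increment :: "nat \<Rightarrow> nat \<Rightarrow> 'w \<Rightarrow> real^'n^'m" where
  "increment s t \<omega> \<equiv> fst (X \<omega> s t) ** snd (X \<omega> s t)"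

text \<open>The constant of \<open>matrix_mult_perturbation\<close> for rank \<open>\<rho>\<close>;
  it is used as \<open>\<kappa>\<close> in \<open>perturbed_descent\<close>.\<close>

abbreviation perturbation :: real where
  "perturbation \<equiv> 8 * c\<^sup>2 * \<rho> + 2 * c ^ 4"

text \<open>The coefficient of the \<open>h^2\<close> term in \<open>perturbed_descent\<close> for
  this \<open>\<kappa>\<close>.\<close>

abbreviation curvature :: real where
  "curvature \<equiv> 2 * q * perturbation + L * (2 + 2 * perturbation)"

text \<open>By the last identity, errors of order \<open>h^2\<close> in each of the
  \<open>T div K\<close> cycles add up to a constant.\<close>

lemma h: "0 < h" "h \<le> 1" "real (T div K) * h\<^sup>2 = 1"
proof -
  have "1 \<le> T div K" using K by (simp add: Suc_le_eq div_greater_zero_iff)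
  then have "1 \<le> real (T div K)" by simp
  then show "0 < h" "h \<le> 1" "real (T div K) * h\<^sup>2 = 1"
    by (auto simp: h_def power_divide)
qed

lemma q: "0 < q"
  unfolding q_def by (simp only: of_nat_0_less_iff min_less_iff_conj zero_less_card_finite simp_thms)

lemma \<rho>: "0 \<le> \<rho>"
  by (simp add: \<rho>_def)

lemma weight_restart_step: "weight K W0 x (restart_step K s) = anchor K W0 x s"
  using K by (simp add: weight_def restart_step_def Let_def)

lemma restart_gradient:
  assumes "restart_step K s \<le> T"
  shows "stochastic_gradient M (H (restart_step K s)) (R (restart_step K s))
    (Gt (restart_step K s)) (\<lambda>\<omega>. gradient l (anchored s \<omega>)) C"
  using full_gradients[OF _ assms] unfolding weight_restart_step by (simp add: restart_step_def)

lemma subalgebras: "subalgebra M (H k)" "subalgebra M (R k)"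
  using hist by (auto simp: histories_def)

lemma increment_measurable:
  assumes "restart_step K s \<le> T" "t \<le> K" "s * K + t \<le> T"
  shows "increment s t \<in> borel_measurable M"
  using X_measurable[OF assms] by (intro borel_measurable_matrix_mult) auto

lemma increment_0:
  assumes "restart_step K s \<le> T" "\<omega> \<in> space M"
  shows "increment s 0 \<omega> = - h *\<^sub>R P (Gt (restart_step K s) \<omega>)"
  using lora_restart_factors(1)[OF restart[OF assms]] h by simp

text \<open>The selection \<open>P\<close> need not be measurable; the projected estimate is, because the restart
  factors determine it.\<close>

lemma projected_estimate_measurable:
  assumes s: "restart_step K s \<le> T"
  shows "(\<lambda>\<omega>. P (Gt (restart_step K s) \<omega>)) \<in> borel_measurable M"
proof -
  have m: "(\<lambda>\<omega>. (- 1 / h) *\<^sub>R increment s 0 \<omega>) \<in> borel_measurable M"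
    using increment_measurable[OF s, of 0] s by (auto simp: restart_step_def)
  have eq: "(- 1 / h) *\<^sub>R increment s 0 \<omega> = P (Gt (restart_step K s) \<omega>)" if "\<omega> \<in> space M" for \<omega>
    using increment_0[OF s that] h by simp
  show ?thesis
    using m by (subst (asm) measurable_cong[OF eq])
qed

lemma projected_estimate_le: "norm (P (Gt k \<omega>)) \<le> norm (Gt k \<omega>)"
  using P by (rule norm_truncated_svd_le)

text \<open>At \<open>t = 0\<close> the product of the factors is exactly \<open>- h\<close> times
  the projected estimate, so the quantity measured is the change of the product since the
  restart.\<close>

lemma increment_perturbation:
  assumes s: "restart_step K s \<le> T" and t: "t \<le> K" and \<omega>: "\<omega> \<in> space M"
  shows "(norm (increment s t \<omega> + h *\<^sub>R P (Gt (restart_step K s) \<omega>)))\<^sup>2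
    \<le> perturbation * h ^ 5 * (1 + (norm (Gt (restart_step K s) \<omega>))\<^sup>2)"
proof -
  have "h *\<^sub>R P (Gt (restart_step K s) \<omega>) = - increment s 0 \<omega>"
    using increment_0[OF s \<omega>] by simp
  moreover have "(norm (increment s t \<omega> - increment s 0 \<omega>))\<^sup>2
    \<le> perturbation * h ^ 5 * (1 + (norm (Gt (restart_step K s) \<omega>))\<^sup>2)"
    using lora_restart_factors(2,3)[OF restart[OF s \<omega>]] displacement[OF t] h
    by (intro matrix_mult_perturbation) (auto simp: \<rho>_def)
  ultimately show ?thesis by simp
qed

section \<open>Square integrability along the run\<close>

lemma increment_square_integrable:
  assumes s: "restart_step K s \<le> T" and t: "t \<le> K" "s * K + t \<le> T"
    and w: "square_integrable M (anchored s)"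
  shows "square_integrable M (increment s t)"
proof (rule square_integrable_bound)
  show "square_integrable M (Gt (restart_step K s))"
    by (rule square_integrable_stochastic_gradient[OF subalgebras C restart_gradient[OF s]
          square_integrable_gradient[OF lip w]])
  show "increment s t \<in> borel_measurable M" by (rule increment_measurable[OF s t])
  show "(norm (increment s t \<omega>))\<^sup>2
      \<le> (2 + 2 * perturbation) * h\<^sup>2 * (1 + (norm (Gt (restart_step K s) \<omega>))\<^sup>2)"
    if "\<omega> \<in> space M" for \<omega>
    \<comment> \<open>The value 1 instantiates \<open>q\<close>; any positive number yields this
      bound.\<close>
    by (rule perturbed_descent(1)[OF diff lip increment_perturbation[OF s t(1) that]
          projected_estimate_le, of 1]) (use h \<rho> in auto)
qed

text \<open>Bootstrapping: the second moment passes from the anchored state to its gradient, then to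
  the restart estimate, to the increment of the cycle, and so to the next anchored state.\<close>

lemma anchored_square_integrable: "s * K \<le> T \<Longrightarrow> square_integrable M (anchored s)"
proof (induction s)
  case 0
  then show ?case by (simp add: square_integrable_def)
next
  case (Suc s)
  have s: "restart_step K s \<le> T" "s * K + K \<le> T"
    using Suc.prems K by (auto simp: restart_step_def)
  have w: "square_integrable M (anchored s)" using Suc s by simp
  show ?case
    using square_integrable_add[OF w increment_square_integrable[OF s(1) order_refl s(2) w]] by simp
qed

lemma weight_square_integrable:
  assumes "k \<le> T"
  shows "square_integrable M (\<lambda>\<omega>. weight K W0 (X \<omega>) k)"
proof (cases "k = 0")
  case True
  then show ?thesis by (simp add: weight_def square_integrable_def)
next
  case False
  define s t where "s = (k - 1) div K" and "t = (k - 1) mod K"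
  have k: "s * K + t = k - 1" by (simp add: s_def t_def)
  then have s: "restart_step K s \<le> T" "s * K + t \<le> T" "s * K \<le> T"
    using assms False by (auto simp: restart_step_def)
  have t: "t \<le> K" using K by (simp add: t_def less_imp_le)
  have w: "square_integrable M (anchored s)" by (rule anchored_square_integrable[OF s(3)])
  show ?thesis
    using w square_integrable_add[OF w increment_square_integrable[OF s(1) t s(2) w]] False
    by (cases "t = 0") (auto simp: weight_def Let_def s_def t_def)
qed

text \<open>The integral of a nonintegrable function is 0 by convention, so integrability is what
  gives the minimum of expectations its meaning.\<close>

lemma spectral_norm_gradient_integrable:
  assumes "k \<le> T"
  shows "integrable M (\<lambda>\<omega>. (spectral_norm (gradient l (weight K W0 (X \<omega>) k)))\<^sup>2)"
proof -
  have G: "square_integrable M (\<lambda>\<omega>. gradient l (weight K W0 (X \<omega>) k))"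
    by (rule square_integrable_gradient[OF lip weight_square_integrable[OF assms]])
  then have [measurable]: "(\<lambda>\<omega>. gradient l (weight K W0 (X \<omega>) k)) \<in> borel_measurable M"
    by (simp add: square_integrable_def)
  have "integrable M (\<lambda>\<omega>. (norm (gradient l (weight K W0 (X \<omega>) k)))\<^sup>2)"
    using G by (simp add: square_integrable_def)
  then show ?thesis
  proof (rule Bochner_Integration.integrable_bound)
    show "(\<lambda>\<omega>. (spectral_norm (gradient l (weight K W0 (X \<omega>) k)))\<^sup>2) \<in> borel_measurable M"
      by measurable
  qed (auto intro!: AE_I2 power_mono spectral_norm_le_norm spectral_norm_nonneg)
qed

lemma expected_spectral_norm_le:
  assumes "k \<le> T"
  shows "(\<integral>\<omega>. (spectral_norm (gradient l (weight K W0 (X \<omega>) k)))\<^sup>2 \<partial>M)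
    \<le> (\<integral>\<omega>. (norm (gradient l (weight K W0 (X \<omega>) k)))\<^sup>2 \<partial>M)"
  using spectral_norm_gradient_integrable[OF assms]
    square_integrable_gradient[OF lip weight_square_integrable[OF assms]]
  by (intro integral_mono power_mono spectral_norm_le_norm spectral_norm_nonneg)
     (auto simp: square_integrable_def)

section \<open>Descent and telescoping over the cycles\<close>

lemma cycle_descent:
  assumes s: "s < T div K" and h_small: "16 * q * curvature * h \<le> 1"
  shows "h / (4 * q) * (\<integral>\<omega>. (norm (gradient l (anchored s \<omega>)))\<^sup>2 \<partial>M)
      + (\<integral>\<omega>. l (anchored (Suc s) \<omega>) \<partial>M)
    \<le> (\<integral>\<omega>. l (anchored s \<omega>) \<partial>M) + q / 2 * (h * (err (restart_step K s))\<^sup>2)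
      + curvature * (1 + 2 * C) * h\<^sup>2"
proof -
  \<comment> \<open>Cycle \<open>s\<close> is complete: its last Adam step still lies within the
    horizon.\<close>
  have "Suc s * K \<le> T div K * K" using s by (intro mult_le_mono1) simp
  also have "\<dots> \<le> T" by simp
  finally have sK: "restart_step K s \<le> T" "s * K + K \<le> T" "s * K \<le> T"
    using K by (auto simp: restart_step_def)
  have bias: "AE \<omega> in M. norm (vec_cond_exp M (H (restart_step K s)) (\<lambda>\<omega>. P (Gt (restart_step K s) \<omega>)) \<omega>
        - P (gradient l (anchored s \<omega>))) \<le> err (restart_step K s)"
    using projection_error[OF _ sK(1)] by (simp add: weight_restart_step) (simp add: restart_step_def)
  have P_ge: "(norm G)\<^sup>2 \<le> q * (G \<bullet> P G)" for G
    unfolding q_def by (rule inner_truncated_svd_ge[OF P]) (simp add: Suc_le_eq)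
  show ?thesis
    unfolding anchor.simps
    by (rule expected_descent[OF subalgebras C restart_gradient[OF sK(1)] diff lip
          anchored_square_integrable[OF sK(3)] projected_estimate_measurable[OF sK(1)]
          increment_measurable[OF sK(1) order_refl sK(2)] projected_estimate_le
          increment_perturbation[OF sK(1) order_refl] bias P_ge q _ h(1,2) h_small]) (use \<rho> in auto)
qed

text \<open>The budget for the whole run: initial excess loss, total projection bias, and the
  \<open>h^2\<close> errors summed by \<open>S h^2 = 1\<close> with \<open>S = T div K\<close>. It
  does not change with the horizon.\<close>

definition gap :: real where
  "gap = l W0 - Inf (range l) + q / 2 * E + curvature * (1 + 2 * C)"

text \<open>The first steps of the complete cycles are distinct restart steps up to
  \<open>T\<close>; an unfinished last cycle may add one more nonnegative term on the right.\<close>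

lemma restart_error_sum: "(\<Sum>s<T div K. h * (err (restart_step K s))\<^sup>2) \<le> E"
proof -
  have inj: "inj_on (restart_step K) {..<T div K}"
    using K by (auto simp: inj_on_def restart_step_def)
  have "(\<Sum>s<T div K. h * (err (restart_step K s))\<^sup>2)
      = (\<Sum>k\<in>restart_step K ` {..<T div K}. h * (err k)\<^sup>2)"
    by (simp add: sum.reindex[OF inj])
  also have "\<dots> \<le> (\<Sum>k | 1 \<le> k \<and> k \<le> T \<and> (k - 1) mod K = 0. h * (err k)\<^sup>2)"
  proof (rule sum_mono2)
    show "finite {k. 1 \<le> k \<and> k \<le> T \<and> (k - 1) mod K = 0}"
      by (rule finite_subset[of _ "{..T}"]) auto
    show "restart_step K ` {..<T div K} \<subseteq> {k. 1 \<le> k \<and> k \<le> T \<and> (k - 1) mod K = 0}"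
    proof clarsimp
      fix s assume "s < T div K"
      then have "Suc s * K \<le> T div K * K" by (intro mult_le_mono1) simp
      also have "\<dots> \<le> T" by simp
      finally show "Suc 0 \<le> restart_step K s \<and> restart_step K s \<le> T \<and>
          (restart_step K s - Suc 0) mod K = 0"
        using K by (simp add: restart_step_def)
    qed
  qed (use h in auto)
  finally show ?thesis using error_sum by simp
qed

text \<open>\<open>cycle_descent\<close> telescopes from the deterministic start \<open>W0\<close>,
  and the final expected loss is at least the infimum of \<open>l\<close>.\<close>

lemma sum_expected_gradients_le:
  assumes h_small: "16 * q * curvature * h \<le> 1"
  shows "h / (4 * q) * (\<Sum>s<T div K. \<integral>\<omega>. (norm (gradient l (anchored s \<omega>)))\<^sup>2 \<partial>M) \<le> gap"
proof -
  define N where "N s = (\<integral>\<omega>. (norm (gradient l (anchored s \<omega>)))\<^sup>2 \<partial>M)" for s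
  define \<Phi> where "\<Phi> s = (\<integral>\<omega>. l (anchored s \<omega>) \<partial>M)" for s
  have "h / (4 * q) * (\<Sum>s<j. N s) + \<Phi> j
      \<le> l W0 + q / 2 * (\<Sum>s<j. h * (err (restart_step K s))\<^sup>2)
        + j * (curvature * (1 + 2 * C) * h\<^sup>2)" if "j \<le> T div K" for j
    using that
  proof (induction j)
    case 0
    then show ?case by (simp add: \<Phi>_def prob_space)
  next
    case (Suc j)
    then show ?case
      using cycle_descent[of j] h_small
      by (simp add: N_def \<Phi>_def distrib_left distrib_right)
  qed
  from this[OF order_refl]
  have "h / (4 * q) * (\<Sum>s<T div K. N s) + \<Phi> (T div K)
      \<le> l W0 + q / 2 * (\<Sum>s<T div K. h * (err (restart_step K s))\<^sup>2)
        + curvature * (1 + 2 * C) * (real (T div K) * h\<^sup>2)"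
    by (simp add: ac_simps)
  moreover have "q / 2 * (\<Sum>s<T div K. h * (err (restart_step K s))\<^sup>2) \<le> q / 2 * E"
    by (rule mult_left_mono[OF restart_error_sum]) (use q in simp)
  moreover have "Inf (range l) \<le> \<Phi> (T div K)"
  proof -
    have "(\<integral>\<omega>. Inf (range l) \<partial>M) \<le> \<Phi> (T div K)"
      unfolding \<Phi>_def
      by (intro integral_mono integrable_loss[OF diff lip anchored_square_integrable])
         (auto intro: cInf_lower bounded_below)
    then show ?thesis by (simp add: prob_space)
  qed
  ultimately show ?thesis
    unfolding gap_def N_def[symmetric] h(3) by linarith
qed

text \<open>The minimum is at most the average over restart steps, which is of order
  \<open>1 / (S * h) = 1 / sqrt S\<close>; since \<open>K\<close> is fixed, \<open>S\<close> and
  \<open>T\<close> are comparable.\<close>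

lemma min_expected_spectral_norm_le:
  assumes h_small: "16 * q * curvature * h \<le> 1" and T: "2 * K \<le> T"
  shows "(MIN k\<in>{..<T}. \<integral>\<omega>. (spectral_norm (gradient l (weight K W0 (X \<omega>) k)))\<^sup>2 \<partial>M)
    \<le> 8 * q * gap * sqrt (2 * real K) / sqrt (real T)"
proof -
  define S where "S = T div K"
  define \<mu> where "\<mu> = (MIN k\<in>{..<T}. \<integral>\<omega>. (spectral_norm (gradient l (weight K W0 (X \<omega>) k)))\<^sup>2 \<partial>M)"
  define N where "N s = (\<integral>\<omega>. (norm (gradient l (anchored s \<omega>)))\<^sup>2 \<partial>M)" for s
  have S: "2 \<le> S"
    using div_le_mono[OF T, of K] K by (simp add: S_def)
  \<comment> \<open>The last complete cycle is left out: the minimum runs over \<open>k < T\<close>,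
    and for \<open>K = 1\<close> its restart step equals \<open>T\<close>.\<close>
  have \<mu>_le: "\<mu> \<le> N s" if s: "s < S - 1" for s
  proof -
    have "restart_step K s < Suc (Suc s) * K"
      using K by (simp add: restart_step_def)
    also have "\<dots> \<le> S * K" using s by (intro mult_le_mono1) simp
    also have "\<dots> \<le> T" by (simp add: S_def)
    finally have less: "restart_step K s < T" .
    then have "\<mu> \<le> (\<integral>\<omega>. (spectral_norm (gradient l (weight K W0 (X \<omega>) (restart_step K s))))\<^sup>2 \<partial>M)"
      unfolding \<mu>_def by (intro Min_le) auto
    also have "\<dots> \<le> N s"
      using expected_spectral_norm_le[of "restart_step K s"] less
      by (simp add: N_def weight_restart_step)
    finally show ?thesis .
  qed
  have "real (S - 1) * \<mu> = (\<Sum>s<S - 1. \<mu>)" by simp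
  also have "\<dots> \<le> (\<Sum>s<S - 1. N s)" by (intro sum_mono \<mu>_le) simp
  also have "\<dots> \<le> (\<Sum>s<S. N s)"
    by (intro sum_mono2) (auto simp: N_def)
  finally have "h / (4 * q) * (real (S - 1) * \<mu>) \<le> gap"
    using sum_expected_gradients_le[OF h_small] h q mult_left_mono[of "real (S - 1) * \<mu>" "\<Sum>s<S. N s" "h / (4 * q)"]
    by (simp add: S_def N_def)
  then have A: "real (S - 1) * \<mu> \<le> 4 * q * gap * sqrt (real S)"
    using q S by (simp add: h_def S_def[symmetric] field_simps)
  have \<mu>: "0 \<le> \<mu>"
  proof -
    have "\<mu> \<in> (\<lambda>k. \<integral>\<omega>. (spectral_norm (gradient l (weight K W0 (X \<omega>) k)))\<^sup>2 \<partial>M) ` {..<T}"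
      unfolding \<mu>_def using K T by (intro Min_in) (auto simp: lessThan_empty_iff)
    then show ?thesis by auto
  qed
  \<comment> \<open>Leaving out one of at least two cycles costs a factor 2, which turns the
    constant 4 into 8.\<close>
  have "real S / 2 * \<mu> \<le> real (S - 1) * \<mu>"
    using S \<mu> by (intro mult_right_mono) (auto simp: of_nat_diff)
  with A have A2: "real S * \<mu> \<le> 8 * q * gap * sqrt (real S)" by simp
  have "sqrt (real S) * (sqrt (real S) * \<mu>) = (sqrt (real S) * sqrt (real S)) * \<mu>"
    by (simp only: mult.assoc)
  also have "\<dots> \<le> sqrt (real S) * (8 * q * gap)"
    using A2 by (simp add: mult.commute)
  finally have B: "sqrt (real S) * \<mu> \<le> 8 * q * gap"
    using S by (subst (asm) mult_le_cancel_left_pos) auto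
  \<comment> \<open>The part of the horizon after the last complete cycle is shorter than
    \<open>K\<close>, hence \<open>T\<close> is at most \<open>2 * K * S\<close>.\<close>
  have "T < Suc S * K"
    unfolding S_def using K by (metis dividend_less_div_times less_le_trans mult_Suc zero_less_one)
  also have "\<dots> \<le> 2 * S * K" using S by (intro mult_le_mono1) simp
  finally have "T \<le> 2 * K * S" by (simp add: ac_simps)
  then have "real T \<le> real (2 * K * S)" by (rule of_nat_mono)
  then have "sqrt (real T) \<le> sqrt (2 * real K) * sqrt (real S)"
    by (simp add: real_sqrt_mult[symmetric])
  from mult_right_mono[OF this \<mu>]
  have "sqrt (real T) * \<mu> \<le> sqrt (2 * real K) * (sqrt (real S) * \<mu>)"
    by (simp only: mult.assoc)
  also have "\<dots> \<le> sqrt (2 * real K) * (8 * q * gap)"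
    using B by (rule mult_left_mono) simp
  finally show ?thesis
    using K T by (simp add: \<mu>_def[symmetric] field_simps)
qed

end

section \<open>Constants uniform in the horizon and the asymptotic bound\<close>

theorem theorem5p1:
  fixes l :: "real^'n^'m \<Rightarrow> real" and W0 :: "real^'n^'m" and K :: nat
    and P :: "real^'n^'m \<Rightarrow> real^'n^'m"
    and L C Lf Cf E \<beta>2 \<beta>1bar eps :: real and \<beta>1 :: "nat \<Rightarrow> real"
    and \<eta> :: "nat \<Rightarrow> nat \<Rightarrow> real" and \<alpha> :: "nat \<Rightarrow> nat \<Rightarrow> nat \<Rightarrow> real"
    and err :: "nat \<Rightarrow> nat \<Rightarrow> real"
    and M :: "nat \<Rightarrow> 'w measure" and H R :: "nat \<Rightarrow> nat \<Rightarrow> 'w measure"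
    and Gt :: "nat \<Rightarrow> nat \<Rightarrow> 'w \<Rightarrow> real^'n^'m"
    and x0 :: "nat \<Rightarrow> nat \<Rightarrow> 'w \<Rightarrow> ('m, 'r::finite, 'n) factors"
    and g :: "nat \<Rightarrow> nat \<Rightarrow> nat \<Rightarrow> 'w \<Rightarrow> ('m, 'r, 'n) factors"
    and X :: "nat \<Rightarrow> 'w \<Rightarrow> nat \<Rightarrow> nat \<Rightarrow> ('m, 'r, 'n) factors"
    and Wt W :: "nat \<Rightarrow> nat \<Rightarrow> 'w \<Rightarrow> real^'n^'m"
  assumes K: "K \<ge> 1"
    and P: "\<And>G. is_truncated_svd CARD('r) G (P G)"
    \<comment> \<open>hyperparameters; everything below indexed by T belongs to the run with horizon T\<close>
    and eta: "\<And>T k. \<eta> T k = 1 / sqrt (real (T div K))"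
    and alpha: "\<And>T s t. \<alpha> T s t = (1 / real (T div K)) / sqrt (real t)"
    and beta2: "0 < \<beta>2" "\<beta>2 < 1"
    and beta1: "0 \<le> \<beta>1bar" "\<beta>1bar < 1" "\<And>t. t \<ge> 1 \<Longrightarrow> 0 \<le> \<beta>1 t \<and> \<beta>1 t \<le> \<beta>1bar"
    and eps: "eps > 0"
    \<comment> \<open>the algorithm\<close>
    and prob: "\<And>T. T \<ge> K \<Longrightarrow> prob_space (M T)"
    and hist: "\<And>T. T \<ge> K \<Longrightarrow> histories (M T) (H T) (R T)"
    and x0_measurable: "\<And>T s. T \<ge> K \<Longrightarrow> restart_step K s \<le> T \<Longrightarrow>
        x0 T s \<in> borel_measurable (R T (restart_step K s))"
    and restart: "\<And>T s \<omega>. T \<ge> K \<Longrightarrow> restart_step K s \<le> T \<Longrightarrow> \<omega> \<in> space (M T) \<Longrightarrow>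
        lora_restart P (\<eta> T (restart_step K s)) (Gt T (restart_step K s) \<omega>) (x0 T s \<omega>)"
    and X: "\<And>T \<omega>. X T \<omega> = lora_iterate (\<alpha> T) \<beta>1 \<beta>2 eps (\<lambda>s. x0 T s \<omega>) (\<lambda>s t. g T s t \<omega>)"
    and Wt: "\<And>T s \<omega>. Wt T s \<omega> = anchor K W0 (X T \<omega>) s"
    and W: "\<And>T k \<omega>. W T k \<omega> = weight K W0 (X T \<omega>) k"
    \<comment> \<open>assumption (1)\<close>
    and bounded_below: "bdd_below (range l)"
    and diff: "\<And>Y. l differentiable (at Y)"
    and smooth: "L-lipschitz_on UNIV (gradient l)"
    \<comment> \<open>assumption (2)\<close>
    and C: "C > 0"
    and full_gradients: "\<And>T k. T \<ge> K \<Longrightarrow> 1 \<le> k \<Longrightarrow> k \<le> T \<Longrightarrow>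
        stochastic_gradient (M T) (H T k) (R T k) (Gt T k) (\<lambda>\<omega>. gradient l (W T k \<omega>)) C"
    \<comment> \<open>assumption (3); Adam step t of cycle s takes place in iteration sK + t\<close>
    and lora_smooth: "\<And>T s. T \<ge> K \<Longrightarrow> restart_step K s \<le> T \<Longrightarrow>
        AE \<omega> in M T. Lf-lipschitz_on (convex hull {X T \<omega> s t | t. t \<le> K \<and> s * K + t \<le> T})
          (gradient (lora_objective l (Wt T s \<omega>)))"
    and lora_gradients: "\<And>T s t. T \<ge> K \<Longrightarrow> 1 \<le> t \<Longrightarrow> t \<le> K \<Longrightarrow> s * K + t \<le> T \<Longrightarrow>
        stochastic_gradient (M T) (R T (s * K + t)) (H T (Suc (s * K + t))) (g T s t)
          (\<lambda>\<omega>. gradient (lora_objective l (Wt T s \<omega>)) (X T \<omega> s (t - 1))) Cf"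
    \<comment> \<open>assumption (4)\<close>
    and projection_error: "\<And>T k. T \<ge> K \<Longrightarrow> 1 \<le> k \<Longrightarrow> k \<le> T \<Longrightarrow> (k - 1) mod K = 0 \<Longrightarrow>
        AE \<omega> in M T. norm (vec_cond_exp (M T) (H T k) (\<lambda>\<omega>. P (Gt T k \<omega>)) \<omega>
                            - P (gradient l (W T k \<omega>))) \<le> err T k"
    and error_sum: "\<And>T. T \<ge> K \<Longrightarrow>
        (\<Sum>k | 1 \<le> k \<and> k \<le> T \<and> (k - 1) mod K = 0. \<eta> T k * (err T k)\<^sup>2) \<le> E"
  shows "(\<forall>T\<ge>K. \<forall>k<T. integrable (M T) (\<lambda>\<omega>. (spectral_norm (gradient l (W T k \<omega>)))\<^sup>2)) \<and>
    (\<lambda>T. MIN k\<in>{..<T}. \<integral>\<omega>. (spectral_norm (gradient l (W T k \<omega>)))\<^sup>2 \<partial>M T)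
      \<in> O(\<lambda>T. 1 / sqrt (real T))"
proof -
  have measurable_fst_snd: "(\<lambda>\<omega>. fst (f \<omega>)) \<in> borel_measurable N \<and> (\<lambda>\<omega>. snd (f \<omega>)) \<in> borel_measurable N"
    if "f \<in> borel_measurable N" for f :: "'w \<Rightarrow> ('m, 'r, 'n) factors" and N
    using that by (auto intro!: borel_measurable_continuous_on[of fst] borel_measurable_continuous_on[of snd]
        continuous_intros)
  define b where "b = adam_step_bound \<beta>1bar \<beta>2 K"
  \<comment> \<open>At most \<open>K\<close> steps per cycle; adding the entry counts of both
    factors gives one constant that serves for either.\<close>
  define c where "c = real K * (CARD('m) * CARD('r) * b + CARD('r) * CARD('n) * b)"
  define q where "q = real (min CARD('m) CARD('n))"
  define \<rho> where "\<rho> = real CARD('r)"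
  define h where "h T = 1 / sqrt (real (T div K))" for T
  have b: "0 \<le> b" unfolding b_def using beta1(2) beta2 by (rule adam_step_bound_nonneg)
  have run: "peso_run (M T) l W0 P L C E c (h T) q \<rho> K T (err T) (H T) (R T) (Gt T) (X T)"
    if T: "K \<le> T" for T
  proof -
    have S: "1 \<le> T div K" using K T by (simp add: Suc_le_eq div_greater_zero_iff)
    have h2: "(h T)\<^sup>2 = 1 / real (T div K)" by (simp add: h_def power_divide)
    have X0: "X T \<omega> s 0 = x0 T s \<omega>" for \<omega> s by (simp add: X lora_iterate_def)
    have sub: "subalgebra (M T) (H T k)" "subalgebra (M T) (R T k)" for k
      using hist[OF T] by (auto simp: histories_def)
    \<comment> \<open>Stated for a matrix of arbitrary shape so that it applies to \<open>A\<close>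
      and to \<open>B\<close>; \<open>card\<close> holds for both shapes.\<close>
    have displacement: "norm (adam_iterate (\<alpha> T s) \<beta>1 \<beta>2 eps y f t - y) \<le> c * (h T)\<^sup>2"
      if t: "t \<le> K" and card: "CARD('d) * CARD('e) * b \<le> CARD('m) * CARD('r) * b + CARD('r) * CARD('n) * b"
      for s t f and y :: "real^'e^'d"
    proof -
      have "norm (adam_iterate (\<alpha> T s) \<beta>1 \<beta>2 eps y f t - y)
          \<le> t * ((h T)\<^sup>2 * (CARD('d) * CARD('e) * b))"
        unfolding b_def
      proof (rule adam_displacement_le[OF beta2 eps beta1(2,3) _ t])
        fix j :: nat assume "1 \<le> j"
        \<comment> \<open>The step size \<open>(1/S) / sqrt j\<close> is largest at
          \<open>j = 1\<close>, where it equals \<open>1/S\<close>, the square of the restart step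
          size.\<close>
        then show "0 \<le> \<alpha> T s j \<and> \<alpha> T s j \<le> (h T)\<^sup>2"
          using S by (simp add: alpha h2 field_simps)
      qed
      also have "\<dots> \<le> K * ((h T)\<^sup>2 * (CARD('m) * CARD('r) * b + CARD('r) * CARD('n) * b))"
        using t card b by (intro mult_mono) auto
      finally show ?thesis by (simp add: c_def ac_simps)
    qed
    interpret prob_space "M T" by (rule prob[OF T])
    show ?thesis
    proof unfold_locales
      fix s t assume s: "restart_step K s \<le> T" and t: "t \<le> K" "s * K + t \<le> T"
      have x0_M: "x0 T s \<in> borel_measurable (M T)"
        by (rule measurable_from_subalg[OF sub(2) x0_measurable[OF T s]])
      \<comment> \<open>Adam step \<open>j\<close> belongs to iteration \<open>s * K + j\<close>,
        which is within the horizon because \<open>j\<close> is at most \<open>t\<close>.\<close>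
      have g_M: "g T s j \<in> borel_measurable (M T)" if "1 \<le> j" "j \<le> t" for j
        using lora_gradients[OF T that(1), of s] that t
        by (auto simp: stochastic_gradient_def intro: measurable_from_subalg[OF sub(1)])
      show "(\<lambda>\<omega>. fst (X T \<omega> s t)) \<in> borel_measurable (M T) \<and> (\<lambda>\<omega>. snd (X T \<omega> s t)) \<in> borel_measurable (M T)"
        unfolding X lora_iterate_def fst_conv snd_conv
        using measurable_fst_snd[OF x0_M] measurable_fst_snd[OF g_M]
        by (intro conjI borel_measurable_adam_iterate) auto
    next
      fix s \<omega> assume "restart_step K s \<le> T" "\<omega> \<in> space (M T)"
      from restart[OF T this] show "lora_restart P (h T) (Gt T (restart_step K s) \<omega>) (X T \<omega> s 0)"
        by (simp add: X0 eta h_def)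
    next
      fix s t \<omega> assume "t \<le> K"
      then show "norm (fst (X T \<omega> s t) - fst (X T \<omega> s 0)) \<le> c * (h T)\<^sup>2 \<and>
          norm (snd (X T \<omega> s t) - snd (X T \<omega> s 0)) \<le> c * (h T)\<^sup>2"
        unfolding X0 unfolding X lora_iterate_def fst_conv snd_conv
        using b by (intro conjI displacement) auto
    next
      show "(\<Sum>k | 1 \<le> k \<and> k \<le> T \<and> (k - 1) mod K = 0. h T * (err T k)\<^sup>2) \<le> E"
        using error_sum[OF T] by (simp add: eta h_def)
    qed (use K T P hist[OF T] bounded_below diff smooth C full_gradients[OF T] projection_error[OF T]
      in \<open>auto simp: h_def q_def \<rho>_def W\<close>)
  qed
  define D where "D = 8 * q * peso_run.gap l W0 L C E c q \<rho> * sqrt (2 * real K)"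
  \<comment> \<open>This is \<open>16 * q * curvature\<close>, so the smallness condition on the
    step size reads \<open>B * h T \<le> 1\<close>.\<close>
  define B where "B = 16 * q * (2 * q * (8 * c\<^sup>2 * \<rho> + 2 * c ^ 4) + L * (2 + 2 * (8 * c\<^sup>2 * \<rho> + 2 * c ^ 4)))"
  define \<mu> where "\<mu> T = (MIN k\<in>{..<T}. \<integral>\<omega>. (spectral_norm (gradient l (W T k \<omega>)))\<^sup>2 \<partial>M T)" for T
  have "\<mu> \<in> O(\<lambda>T. 1 / sqrt (real T))"
  proof (rule bigoI)
    show "eventually (\<lambda>T. norm (\<mu> T) \<le> D * norm (1 / sqrt (real T))) sequentially"
      \<comment> \<open>The threshold forces at least \<open>2 + B^2\<close> cycles: the 2 gives
        \<open>2 * K \<le> T\<close>, and the rest gives \<open>B \<le> sqrt S\<close>.\<close>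
      using eventually_ge_at_top[of "K * (2 + nat \<lceil>B\<^sup>2\<rceil>)"]
    proof eventually_elim
      fix T assume T: "K * (2 + nat \<lceil>B\<^sup>2\<rceil>) \<le> T"
      then have T2: "2 * K \<le> T" by (simp add: distrib_left mult.commute)
      then have KT: "K \<le> T" by simp
      interpret peso_run "M T" l W0 P L C E c "h T" q \<rho> K T "err T" "H T" "R T" "Gt T" "X T"
        by (rule run[OF KT])
      have "2 + nat \<lceil>B\<^sup>2\<rceil> \<le> T div K"
        using div_le_mono[OF T, of K] K by simp
      then have "B\<^sup>2 \<le> real (T div K)" by linarith
      then have "B \<le> sqrt (real (T div K))" by (rule real_le_rsqrt)
      then have "B * h T \<le> 1"
        using h(1) by (simp add: h_def divide_le_eq)
      then have "\<mu> T \<le> D / sqrt (real T)"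
        using min_expected_spectral_norm_le[OF _ T2] by (simp add: \<mu>_def D_def B_def W)
      moreover have "0 \<le> \<mu> T"
      proof -
        have "\<mu> T \<in> (\<lambda>k. \<integral>\<omega>. (spectral_norm (gradient l (W T k \<omega>)))\<^sup>2 \<partial>M T) ` {..<T}"
          unfolding \<mu>_def using K(1) KT by (intro Min_in) (auto simp: lessThan_empty_iff)
        then show ?thesis by auto
      qed
      ultimately show "norm (\<mu> T) \<le> D * norm (1 / sqrt (real T))" by simp
    qed
  qed
  moreover have "integrable (M T) (\<lambda>\<omega>. (spectral_norm (gradient l (W T k \<omega>)))\<^sup>2)" if "K \<le> T" "k < T" for T k
    unfolding W using peso_run.spectral_norm_gradient_integrable[OF run[OF that(1)]] that(2) by simp
  ultimately show ?thesis unfolding \<mu>_def by blast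
qed

end
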